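(* Let $b\ge2$ be an integer. There are constants $\mu_d$ and $\sigma_d^2$ (depending only on $b$) such that the number of distinct parts in a random composition of $1$ into $m=(b-1)n+1$ parts (powers of $b$) is asymptotically normally distributed (as $n\to\infty$) with mean $\mu_d n+O(1)$ and variance $\sigma_d^2 n+O(1)$.
   Context: For an integer $n\ge0$ and $m=(b-1)n+1$, a composition of $1$ into $m$ powers of $b$ is an $m$-tuple $\mathbf{k}=(k_1,\ldots,k_m)$ of nonnegative integers with $b^{-k_1}+b^{-k_2}+\cdots+b^{-k_m}=1$. There are finitely many such compositions for each $n$, and a random composition is one chosen uniformly at random among them. The number of distinct parts of $\mathbf{k}$ is the number of distinct values among $k_1,\ldots,k_m$. A sequence of random variables $X_n$ is asymptotically normally distributed if $(X_n-\mathbb{E}X_n)/\sqrt{\mathrm{Var}\,X_n}$ converges in distribution to the standard normal distribution. *)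

theory Defs
  imports "HOL-Probability.Probability" "HOL-Library.Landau_Symbols"
begin

definition compositions :: "nat \<Rightarrow> nat \<Rightarrow> nat list set" where
  "compositions b m = {ks. length ks = m \<and> (\<Sum>k\<leftarrow>ks. 1 / real b ^ k) = 1}"

definition distinct_parts :: "nat list \<Rightarrow> nat" where
  "distinct_parts ks = card (set ks)"

text \<open>
  Each \<^term>\<open>X n\<close> may live on its own probability space \<^term>\<open>M n\<close>.
  If the variance vanishes, division by zero makes the normalised variable constantly 0, so
  weak convergence to the standard normal law forces the variance to be nonzero infinitely
  often (in fact, eventually).
\<close>
definition asymptotically_normal :: "(nat \<Rightarrow> 'a measure) \<Rightarrow> (nat \<Rightarrow> 'a \<Rightarrow> real) \<Rightarrow> bool" where
  "asymptotically_normal M X \<longleftrightarrow>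
     weak_conv_m
       (\<lambda>n. distr (M n) borel
              (\<lambda>\<omega>. (X n \<omega> - prob_space.expectation (M n) (X n)) /
                    sqrt (prob_space.variance (M n) (X n))))
       std_normal_distribution"

text \<open>
  \<^term>\<open>pmf_of_set A\<close> is the uniform distribution only for finite nonempty \<^term>\<open>A\<close>;
  the next lemmas establish this for the sets in question.
\<close>
definition random_composition :: "nat \<Rightarrow> nat \<Rightarrow> nat list pmf" where
  "random_composition b n = pmf_of_set (compositions b ((b - 1) * n + 1))"

lemma finite_power_sum_lists:
  fixes q :: real
  assumes b: "b \<ge> 2"
  shows "q > 0 \<Longrightarrow> finite {ks. length ks = m \<and> (\<Sum>k\<leftarrow>ks. 1 / real b ^ k) = q}"
proof (induction m arbitrary: q)
  case 0
  then show ?case by (simp add: finite_subset[of _ "{[]}"])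
next
  case (Suc m)
  let ?w = "\<lambda>ks::nat list. \<Sum>k\<leftarrow>ks. 1 / real b ^ k"
  let ?S = "\<lambda>q. {ks. length ks = m \<and> ?w ks = q}"
  let ?ins = "\<lambda>i k ks. take i ks @ k # drop i ks"
  have fin: "finite (?S r)" for r
  proof (cases "r > 0")
    case True
    then show ?thesis by (rule Suc.IH)
  next
    case False
    have pos: "0 < ?w ks" if "ks \<noteq> []" for ks :: "nat list"
    proof -
      have "1 / real b ^ hd ks > 0" using b by simp
      moreover have "?w (tl ks) \<ge> 0" by (rule sum_list_nonneg) auto
      ultimately show ?thesis using that
        by (cases ks) (auto simp del: zero_less_divide_1_iff intro: add_pos_nonneg)
    qed
    have "?S r \<subseteq> {[]}" using pos False by force
    then show ?thesis by (rule finite_subset) simp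
  qed
  obtain K where K: "(1 / 2) ^ K < q / real (Suc m)"
    using real_arch_pow_inv[of "q / real (Suc m)" "1 / 2"] Suc.prems by auto
  have bound: "1 / real b ^ k < q / real (Suc m)" if "k \<ge> K" for k
  proof -
    have "1 / real b ^ k = (1 / real b) ^ k" by (simp add: power_divide)
    also have "\<dots> \<le> (1 / 2) ^ k" using b by (intro power_mono) (auto simp: field_simps)
    also have "\<dots> \<le> (1 / 2) ^ K" using that by (intro power_decreasing) auto
    finally show ?thesis using K by simp
  qed
  have "{ks. length ks = Suc m \<and> ?w ks = q} \<subseteq>
          (\<Union>i\<in>{..m}. \<Union>k\<in>{..<K}. ?ins i k ` ?S (q - 1 / real b ^ k))"
  proof
    fix ks assume "ks \<in> {ks. length ks = Suc m \<and> ?w ks = q}"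
    then have len: "length ks = Suc m" and w: "?w ks = q" by auto
    have "\<exists>i\<le>m. ks ! i < K"
    proof (rule ccontr)
      assume "\<not> ?thesis"
      then have ge: "ks ! i \<ge> K" if "i < Suc m" for i using that by (force simp: less_Suc_eq_le)
      have "?w ks = (\<Sum>i<Suc m. 1 / real b ^ (ks ! i))"
        using len by (simp add: sum_list_sum_nth atLeast0LessThan)
      also have "\<dots> < (\<Sum>i<Suc m. q / real (Suc m))"
        using ge bound by (intro sum_strict_mono) auto
      also have "\<dots> = q" by simp
      finally show False using w by simp
    qed
    then obtain i where i: "i \<le> m" "ks ! i < K" by auto
    define ks' where "ks' = take i ks @ drop (Suc i) ks"
    have split: "ks = take i ks @ ks ! i # drop (Suc i) ks"
      using i len by (simp add: id_take_nth_drop)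
    have "?w ks = ?w ks' + 1 / real b ^ (ks ! i)"
      by (subst split) (simp add: ks'_def)
    then have "ks' \<in> ?S (q - 1 / real b ^ (ks ! i))"
      using w i len by (simp add: ks'_def)
    moreover have "ks = ?ins i (ks ! i) ks'"
      using i len split by (simp add: ks'_def)
    ultimately show "ks \<in> (\<Union>i\<in>{..m}. \<Union>k\<in>{..<K}. ?ins i k ` ?S (q - 1 / real b ^ k))"
      using i by blast
  qed
  then show ?case by (rule finite_subset) (use fin in auto)
qed

lemma finite_compositions: "b \<ge> 2 \<Longrightarrow> finite (compositions b m)"
  unfolding compositions_def by (rule finite_power_sum_lists) auto

lemma compositions_nonempty:
  assumes b: "b \<ge> 2"
  shows "compositions b ((b - 1) * n + 1) \<noteq> {}"
proof -
  have "\<exists>ks. length ks = (b - 1) * n \<and> (\<Sum>k\<leftarrow>ks. 1 / real b ^ k) + 1 / real b ^ n = 1"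
  proof (induction n)
    case 0
    then show ?case by simp
  next
    case (Suc n)
    then obtain ks where ks: "length ks = (b - 1) * n"
      "(\<Sum>k\<leftarrow>ks. 1 / real b ^ k) + 1 / real b ^ n = 1" by blast
    have "real (b - 1) / real b ^ Suc n + 1 / real b ^ Suc n = 1 / real b ^ n"
      using b by (simp add: of_nat_diff field_simps)
    moreover have "length (replicate (b - 1) (Suc n) @ ks) = (b - 1) * Suc n"
      using ks(1) by simp
    ultimately show ?case using ks(2)
      by (intro exI[of _ "replicate (b - 1) (Suc n) @ ks"] conjI)
         (simp_all add: sum_list_replicate)
  qed
  then obtain ks where "length ks = (b - 1) * n"
    "(\<Sum>k\<leftarrow>ks. 1 / real b ^ k) + 1 / real b ^ n = 1" by blast
  then have "n # ks \<in> compositions b ((b - 1) * n + 1)"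
    by (simp add: compositions_def)
  then show ?thesis by blast
qed

end

theory Submission
  imports Defs "HOL-Complex_Analysis.Complex_Analysis" "HOL-Combinatorics.Combinatorics"
begin

text \<open>
  A composition of 1 is read as the leaf levels of a rooted tree whose inner vertices have \<open>b\<close> children:
  if a level has \<open>s\<close> inner vertices, the next one consists of \<open>t \<le> b s\<close> inner vertices and \<open>b s - t\<close> leaves.
  Up to the factor \<open>m!\<close>, counting compositions thus means summing \<open>\<Prod> 1 / (b s - t)!\<close> over paths of the
  state \<open>s\<close> from 1 to 0, and the number of distinct parts is the number of steps with \<open>t < b s\<close>.

  Cutting the path at its visits to the state 1 gives a renewal equation \<open>U = E + F U\<close>. Excursions that avoid 1
  have an exponentially smaller weight because a superharmonic function exists at a point beyond the root
  \<open>r\<close> of \<open>F(r) = 1\<close>; hence after tilting by \<open>r\<close> all cycle lengths have geometric tails, and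
  \<open>1 / (1 - F)\<close> has coefficients converging geometrically to a positive constant.

  With \<open>\<mu>\<close> chosen such that the reward centred by \<open>\<mu>\<close> times the length has mean zero over a cycle, the first
  two moments satisfy renewal equations that are solved in the same way. The characteristic function
  satisfies \<open>u\<^sub>n = A - z (u\<^sub>0 + \<dots> + u\<^sub>n)\<close> up to a small error, where \<open>z\<close> is \<open>\<sigma>\<^sup>2 \<theta>\<^sup>2 / 2\<close> up to \<open>O(\<theta>\<^sup>3)\<close>, so it
  behaves like \<open>A / (1 + z)\<^sup>n\<close>; Levy's continuity theorem finishes the proof.
\<close>

section \<open>Power series with geometrically decaying coefficients\<close>

text \<open>The states are unbounded, so there is no finite transfer matrix; regeneration at the
  state 1 takes its place. This state is convenient because the cycle 1 -> 1 exists: its length 1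
  excludes periodicity, and its weight \<open>1 / fact (b - 1)\<close> is explicit. The delicate
  point is that the cycle series must still converge at some \<open>x\<close> where its value
  exceeds 1. A superharmonic function gives convergence at \<open>x\<close>, and
  \<open>x >= fact (b - 1)\<close> makes the cycle 1 -> 1 alone contribute at least 1; the cycle 1
  -> 2 -> 1 makes the value strictly larger. That second cycle has a reward below its length 3,
  whereas 1 -> 1 has reward 1 and length 1. So the reward is not proportional to the length, which
  is why the variance constant is positive. The marking variable stays on the unit circle. At
  arguments \<theta> of order \<open>1 / sqrt n\<close>, an error O(\<theta>) in the equation for
  \<open>u\<close>, uniform in the index, is enough: over \<open>n\<close> steps it is amplified
  only by \<open>n * z\<close>, which stays bounded.\<close>

definition geom_decay :: "'a::real_normed_field fps \<Rightarrow> bool" where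
  "geom_decay a \<longleftrightarrow> (\<exists>C q. 0 < q \<and> q < 1 \<and> (\<forall>n. norm (fps_nth a n) \<le> C * q ^ n))"

lemma geom_decayI:
  assumes "0 < q" "q < 1" "\<And>n. norm (fps_nth a n) \<le> C * q ^ n"
  shows "geom_decay a"
  using assms unfolding geom_decay_def by blast

lemma geom_decayE:
  assumes "geom_decay a"
  obtains C q where "0 < q" "q < 1" "C \<ge> 0" "\<And>n. norm (fps_nth a n) \<le> C * q ^ n"
proof -
  from assms obtain C q where *: "0 < q" "q < 1" "\<And>n. norm (fps_nth a n) \<le> C * q ^ n"
    unfolding geom_decay_def by blast
  have "0 \<le> norm (fps_nth a 0)" by simp
  also have "\<dots> \<le> C" using *(3)[of 0] by simp
  finally show ?thesis using * that by blast
qed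

lemma Suc_times_power_bounded:
  fixes p :: real
  assumes "0 < p" "p < 1"
  obtains K where "K \<ge> 0" "\<And>n. real (Suc n) * p ^ n \<le> K"
proof -
  have 1: "(\<lambda>n. real n * p ^ n) \<longlonglongrightarrow> 0"
    using assms by (intro powser_times_n_limit_0) auto
  have 2: "(\<lambda>n. p ^ n) \<longlonglongrightarrow> 0"
    using assms by (intro LIMSEQ_power_zero) auto
  have "(\<lambda>n. real (Suc n) * p ^ n) \<longlonglongrightarrow> 0"
    using tendsto_add[OF 1 2] by (simp add: algebra_simps)
  then have "Bseq (\<lambda>n. real (Suc n) * p ^ n)" by (intro convergent_imp_Bseq convergentI)
  then obtain K where "K > 0" "\<And>n. norm (real (Suc n) * p ^ n) \<le> K" by (elim BseqE) blast
  then show ?thesis by (intro that[of K]) (auto intro: order_trans[OF abs_ge_self])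
qed

text \<open>A linear factor is absorbed by weakening the ratio from \<open>q\<close> to
  \<open>sqrt q\<close>, because \<open>(n + 1) * sqrt q ^ n\<close> is bounded. Iteration handles
  polynomial factors.\<close>

lemma geom_decay_Suc_mono:
  fixes a :: "'a::real_normed_field fps" and b :: "'b::real_normed_field fps"
  assumes b: "geom_decay b"
    and le: "\<And>n. norm (fps_nth a n) \<le> K * real (Suc n) * norm (fps_nth b n)"
  shows "geom_decay a"
proof -
  obtain C q where q: "0 < q" "q < 1" "C \<ge> 0" "\<And>n. norm (fps_nth b n) \<le> C * q ^ n"
    using b by (rule geom_decayE) blast
  obtain M where M: "M \<ge> 0" "\<And>n. real (Suc n) * (sqrt q) ^ n \<le> M"
    using q by (elim Suc_times_power_bounded[of "sqrt q", rotated 2]) auto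
  show ?thesis
  proof (rule geom_decayI)
    show "0 < sqrt q" "sqrt q < 1" using q by auto
    fix n
    have "norm (fps_nth a n) \<le> \<bar>K\<bar> * real (Suc n) * norm (fps_nth b n)"
      by (rule order_trans[OF le], intro mult_right_mono) auto
    also have "\<dots> \<le> \<bar>K\<bar> * real (Suc n) * (C * q ^ n)"
      using q(4) by (intro mult_left_mono) auto
    also have "q ^ n = sqrt q ^ n * sqrt q ^ n"
      using q by (simp flip: power_mult_distrib)
    also have "\<bar>K\<bar> * real (Suc n) * (C * (sqrt q ^ n * sqrt q ^ n))
        = (\<bar>K\<bar> * C * sqrt q ^ n) * (real (Suc n) * sqrt q ^ n)" by simp
    also have "\<dots> \<le> (\<bar>K\<bar> * C * sqrt q ^ n) * M"
      using M q by (intro mult_left_mono) auto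
    finally show "norm (fps_nth a n) \<le> (\<bar>K\<bar> * C * M) * sqrt q ^ n" by (simp add: ac_simps)
  qed
qed

lemma geom_decay_mono:
  fixes a :: "'a::real_normed_field fps" and b :: "'b::real_normed_field fps"
  assumes "geom_decay b" "\<And>n. norm (fps_nth a n) \<le> norm (fps_nth b n)"
  shows "geom_decay a"
proof (rule geom_decay_Suc_mono[of b a 1])
  fix n
  have "norm (fps_nth a n) \<le> 1 * norm (fps_nth b n)" using assms by simp
  also have "\<dots> \<le> real (Suc n) * norm (fps_nth b n)" by (intro mult_right_mono) auto
  finally show "norm (fps_nth a n) \<le> 1 * real (Suc n) * norm (fps_nth b n)" by simp
qed fact

lemma geom_decay_pow_mono:
  fixes a :: "'a::real_normed_field fps" and b :: "'b::real_normed_field fps"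
  assumes b: "geom_decay b"
    and le: "\<And>n. norm (fps_nth a n) \<le> K * real (Suc n) ^ j * norm (fps_nth b n)"
  shows "geom_decay a"
proof -
  have *: "geom_decay (Abs_fps (\<lambda>n. real (Suc n) ^ j * norm (fps_nth b n)))" for j
  proof (induction j)
    case 0
    then show ?case by (intro geom_decay_mono[OF b]) simp
  next
    case (Suc j)
    show ?case by (rule geom_decay_Suc_mono[OF Suc, where K = 1]) simp
  qed
  show ?thesis
  proof (rule geom_decay_Suc_mono[OF *[of j], where K = "\<bar>K\<bar>"])
    fix n
    have "norm (fps_nth a n) \<le> K * (real (Suc n) ^ j * norm (fps_nth b n))"
      using le[of n] by (simp add: mult.assoc)
    also have "\<dots> \<le> \<bar>K\<bar> * (real (Suc n) ^ j * norm (fps_nth b n))"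
      by (intro mult_right_mono) auto
    also have "\<dots> \<le> \<bar>K\<bar> * real (Suc n) * (real (Suc n) ^ j * norm (fps_nth b n))"
      by (intro mult_right_mono) (auto simp: mult_le_cancel_left1)
    finally show "norm (fps_nth a n) \<le> \<bar>K\<bar> * real (Suc n) *
        norm (fps_nth (Abs_fps (\<lambda>n. real (Suc n) ^ j * norm (fps_nth b n))) n)" by simp
  qed
qed

text \<open>With the larger ratio \<open>r\<close> for both series, each of the \<open>n + 1\<close>
  terms of the Cauchy product is at most \<open>C * D * r ^ n\<close>; the number of terms is again
  absorbed by a weaker ratio.\<close>

lemma geom_decay_mult:
  assumes "geom_decay a" "geom_decay b"
  shows "geom_decay (a * b)"
proof -
  obtain C q where q: "0 < q" "q < 1" "C \<ge> 0" "\<And>n. norm (fps_nth a n) \<le> C * q ^ n"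
    using assms(1) by (rule geom_decayE) blast
  obtain D p where p: "0 < p" "p < 1" "D \<ge> 0" "\<And>n. norm (fps_nth b n) \<le> D * p ^ n"
    using assms(2) by (rule geom_decayE) blast
  define r where "r = max q p"
  have r: "0 < r" "r < 1" using p q by (auto simp: r_def)
  have "geom_decay (Abs_fps (\<lambda>n. r ^ n))"
    using r by (intro geom_decayI[of r _ 1]) auto
  then show ?thesis
  proof (rule geom_decay_Suc_mono[where K = "C * D"])
    fix n
    have "norm (fps_nth (a * b) n) \<le> (\<Sum>i=0..n. norm (fps_nth a i * fps_nth b (n - i)))"
      unfolding fps_mult_nth by (rule norm_sum)
    also have "\<dots> \<le> (\<Sum>i=0..n. C * D * r ^ n)"
    proof (rule sum_mono)
      fix i assume i: "i \<in> {0..n}"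
      have "norm (fps_nth a i) \<le> C * r ^ i"
        using q r by (intro order_trans[OF q(4)] mult_left_mono power_mono) (auto simp: r_def)
      moreover have "norm (fps_nth b (n - i)) \<le> D * r ^ (n - i)"
        using p r by (intro order_trans[OF p(4)] mult_left_mono power_mono) (auto simp: r_def)
      ultimately have "norm (fps_nth a i * fps_nth b (n - i)) \<le> (C * r ^ i) * (D * r ^ (n - i))"
        using q r by (simp add: norm_mult mult_mono)
      also have "\<dots> = C * D * r ^ n" using i by (simp flip: power_add)
      finally show "norm (fps_nth a i * fps_nth b (n - i)) \<le> C * D * r ^ n" .
    qed
    also have "\<dots> = C * D * real (Suc n) * r ^ n" by simp
    finally show "norm (fps_nth (a * b) n) \<le> C * D * real (Suc n) * norm (fps_nth (Abs_fps (\<lambda>n. r ^ n)) n)"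
      using r by simp
  qed
qed

lemma geom_decay_add:
  assumes "geom_decay a" "geom_decay b"
  shows "geom_decay (a + b)"
proof -
  obtain C q where q: "0 < q" "q < 1" "C \<ge> 0" "\<And>n. norm (fps_nth a n) \<le> C * q ^ n"
    using assms(1) by (rule geom_decayE) blast
  obtain D p where p: "0 < p" "p < 1" "D \<ge> 0" "\<And>n. norm (fps_nth b n) \<le> D * p ^ n"
    using assms(2) by (rule geom_decayE) blast
  define r where "r = max q p"
  have r: "0 < r" "r < 1" using p q by (auto simp: r_def)
  show ?thesis
  proof (rule geom_decayI[OF r])
    fix n
    have "norm (fps_nth a n) \<le> C * r ^ n"
      using q r by (intro order_trans[OF q(4)] mult_left_mono power_mono) (auto simp: r_def)
    moreover have "norm (fps_nth b n) \<le> D * r ^ n"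
      using p r by (intro order_trans[OF p(4)] mult_left_mono power_mono) (auto simp: r_def)
    ultimately show "norm (fps_nth (a + b) n) \<le> (C + D) * r ^ n"
      by (auto intro: order_trans[OF norm_triangle_ineq] simp: algebra_simps)
  qed
qed

lemma geom_decay_uminus: "geom_decay a \<Longrightarrow> geom_decay (- a)"
  by (erule geom_decay_mono) simp

lemma geom_decay_const_mult: "geom_decay a \<Longrightarrow> geom_decay (fps_const c * a)"
  by (rule geom_decay_pow_mono[of a _ "norm c" 0]) (auto simp: norm_mult)

lemma geom_decay_norm: "geom_decay a \<Longrightarrow> geom_decay (Abs_fps (\<lambda>n. norm (fps_nth a n)))"
  by (erule geom_decay_mono) simp

lemma geom_decay_summable_norm:
  assumes "geom_decay a"
  shows "summable (\<lambda>n. norm (fps_nth a n))"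
proof -
  obtain C q where q: "0 < q" "q < 1" "C \<ge> 0" "\<And>n. norm (fps_nth a n) \<le> C * q ^ n"
    using assms by (rule geom_decayE) blast
  have "summable (\<lambda>n. C * q ^ n)" using q by (intro summable_mult summable_geometric) auto
  then show ?thesis by (rule summable_comparison_test_ev[rotated]) (use q in auto)
qed

lemma geom_decay_summable:
  fixes a :: "'a::{real_normed_field,banach} fps"
  shows "geom_decay a \<Longrightarrow> summable (fps_nth a)"
  using geom_decay_summable_norm summable_norm_cancel by blast

text \<open>The series \<open>1 / (1 - x)\<close>. Multiplication by it forms partial sums, and
  \<open>geom_decay (a - fps_const c * fps_ones)\<close> expresses that the coefficients of
  \<open>a\<close> converge to \<open>c\<close> at a geometric rate.\<close>

abbreviation fps_ones :: "'a::comm_ring_1 fps" where "fps_ones \<equiv> Abs_fps (\<lambda>_. 1)"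

lemma fps_mult_ones_nth: "fps_nth (a * fps_ones) n = (\<Sum>i\<le>n. fps_nth a i)"
  by (simp add: fps_mult_nth atLeast0AtMost)

lemma fps_ones_mult_one_minus_X: "(1 - fps_X) * (fps_ones :: 'a::comm_ring_1 fps) = 1"
  by (rule fps_ext) (simp add: algebra_simps)

text \<open>The difference is the negative tail of the series, which a geometric tail
  dominates.\<close>

lemma geom_decay_partial_sums:
  fixes a :: "'a::{real_normed_field,banach} fps"
  assumes "geom_decay a"
  shows "geom_decay (a * fps_ones - fps_const (\<Sum>n. fps_nth a n) * fps_ones)"
proof -
  obtain C q where q: "0 < q" "q < 1" "C \<ge> 0" "\<And>n. norm (fps_nth a n) \<le> C * q ^ n"
    using assms by (rule geom_decayE) blast
  note sm = geom_decay_summable[OF assms]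
  show ?thesis
  proof (rule geom_decayI[OF q(1,2)])
    fix n
    have gs: "summable (\<lambda>k. q ^ k)" using q by (intro summable_geometric) auto
    have le: "norm (fps_nth a (k + Suc n)) \<le> C * q ^ Suc n * q ^ k" for k
      using q(4)[of "k + Suc n"] by (simp add: power_add ac_simps)
    have "(\<Sum>k. fps_nth a k) = (\<Sum>k. fps_nth a (k + Suc n)) + (\<Sum>i<Suc n. fps_nth a i)"
      using sm by (rule suminf_split_initial_segment)
    then have "norm (fps_nth (a * fps_ones - fps_const (\<Sum>n. fps_nth a n) * fps_ones) n)
        = norm (\<Sum>k. fps_nth a (k + Suc n))"
      by (simp add: fps_mult_ones_nth lessThan_Suc_atMost algebra_simps norm_minus_commute)
    also have "\<dots> \<le> (\<Sum>k. norm (fps_nth a (k + Suc n)))"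
      by (rule summable_norm)
        (rule summable_ignore_initial_segment[OF geom_decay_summable_norm[OF assms]])
    also have "\<dots> \<le> (\<Sum>k. C * q ^ Suc n * q ^ k)"
      by (intro suminf_le le summable_mult gs
          summable_ignore_initial_segment[OF geom_decay_summable_norm[OF assms]])
    also have "\<dots> = C * q ^ Suc n * (1 / (1 - q))"
      using q by (subst suminf_mult[OF gs]) (simp add: suminf_geometric)
    finally show "norm (fps_nth (a * fps_ones - fps_const (\<Sum>n. fps_nth a n) * fps_ones) n)
        \<le> (C * q / (1 - q)) * q ^ n" by (simp add: ac_simps)
  qed
qed

text \<open>Split \<open>u\<close> into its limit and a decaying remainder; the limit turns the
  convolution into partial sums of \<open>a\<close>. If \<open>a\<close> has sum 0, geometric
  convergence of \<open>u\<close> becomes geometric decay of the product.\<close>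

lemma geom_decay_mult_near_const:
  fixes a :: "'a::{real_normed_field,banach} fps"
  assumes a: "geom_decay a" and u: "geom_decay (u - fps_const c * fps_ones)"
  shows "geom_decay (a * u - fps_const (c * (\<Sum>n. fps_nth a n)) * fps_ones)"
proof -
  have "a * u - fps_const (c * (\<Sum>n. fps_nth a n)) * fps_ones
      = a * (u - fps_const c * fps_ones)
        + fps_const c * (a * fps_ones - fps_const (\<Sum>n. fps_nth a n) * fps_ones)"
    by (simp add: algebra_simps flip: fps_const_mult)
  then show ?thesis
    by (simp only:) (intro geom_decay_add geom_decay_mult a u geom_decay_const_mult geom_decay_partial_sums)
qed

section \<open>Geometric decay and the radius of convergence\<close>

lemma conv_radius_gt_1_imp_geom_decay:
  assumes "fps_conv_radius a > 1"
  shows "geom_decay (a :: complex fps)"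
proof -
  obtain z :: real where z: "ereal 1 < ereal z" "ereal z < fps_conv_radius a"
    using ereal_dense2[of 1 "fps_conv_radius a"] assms by (auto simp: one_ereal_def)
  have "summable (\<lambda>n. norm (fps_nth a n * (of_real z) ^ n))"
    using z by (intro norm_summable_fps) auto
  then have "(\<lambda>n. norm (fps_nth a n * (of_real z) ^ n)) \<longlonglongrightarrow> 0" by (rule summable_LIMSEQ_zero)
  then have "Bseq (\<lambda>n. norm (fps_nth a n * (of_real z) ^ n))" by (intro convergent_imp_Bseq convergentI)
  then obtain K where K: "\<And>n. norm (norm (fps_nth a n * (of_real z) ^ n)) \<le> K" by (elim BseqE) blast
  show ?thesis
  proof (rule geom_decayI[of "1 / z"])
    fix n show "norm (fps_nth a n) \<le> K * (1 / z) ^ n"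
      using K[of n] z by (simp add: norm_mult norm_power power_divide field_simps)
  qed (use z in auto)
qed

lemma geom_decay_imp_conv_radius_gt_1:
  fixes a :: "'a::{real_normed_field,banach} fps"
  assumes "geom_decay a"
  shows "fps_conv_radius a > 1"
proof -
  obtain C q where q: "0 < q" "q < 1" "C \<ge> 0" "\<And>n. norm (fps_nth a n) \<le> C * q ^ n"
    using assms by (rule geom_decayE) blast
  \<comment> \<open>A point strictly between 1 and \<open>1 / q\<close>.\<close>
  define z where "z = 1 / sqrt q"
  have z: "z > 1" "norm (of_real z :: 'a) = z" using q by (auto simp: z_def norm_divide)
  have qz: "q * z = sqrt q" using q by (simp add: z_def field_simps)
  have "summable (\<lambda>n. C * sqrt q ^ n)" using q by (intro summable_mult summable_geometric) auto
  then have "summable (\<lambda>n. fps_nth a n * of_real z ^ n)"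
  proof (rule summable_comparison_test[rotated], intro exI[of _ 0] allI impI)
    fix n
    have "norm (fps_nth a n * of_real z ^ n) \<le> (C * q ^ n) * z ^ n"
      using z q(4)[of n] by (simp only: norm_mult norm_power) (intro mult_right_mono, auto)
    then show "norm (fps_nth a n * of_real z ^ n) \<le> C * sqrt q ^ n"
      by (simp add: mult.assoc qz flip: power_mult_distrib)
  qed
  then have "fps_conv_radius a \<ge> norm (of_real z :: 'a)"
    unfolding fps_conv_radius_def by (rule conv_radius_geI)
  then show ?thesis using z by (auto intro: less_le_trans[of "ereal 1" "ereal z"] simp: one_ereal_def)
qed

lemma suminf_mult_geom_decay:
  fixes a b :: "'a::{real_normed_field,banach} fps"
  assumes "geom_decay a" "geom_decay b"
  shows "(\<Sum>n. fps_nth (a * b) n) = (\<Sum>n. fps_nth a n) * (\<Sum>n. fps_nth b n)"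
  using Cauchy_product[OF geom_decay_summable_norm geom_decay_summable_norm, OF assms]
  by (simp add: fps_mult_nth atLeast0AtMost)

definition fps_of_real :: "real fps \<Rightarrow> complex fps" where
  "fps_of_real a = Abs_fps (\<lambda>n. of_real (fps_nth a n))"

lemma fps_of_real_nth [simp]: "fps_nth (fps_of_real a) n = of_real (fps_nth a n)"
  by (simp add: fps_of_real_def)

lemma fps_of_real_mult: "fps_of_real (a * b) = fps_of_real a * fps_of_real b"
  by (rule fps_ext) (simp add: fps_mult_nth)

lemma fps_of_real_diff: "fps_of_real (a - b) = fps_of_real a - fps_of_real b"
  by (rule fps_ext) simp

lemma fps_of_real_1 [simp]: "fps_of_real 1 = 1"
  by (rule fps_ext) simp

lemma fps_of_real_ones [simp]: "fps_of_real fps_ones = fps_ones"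
  by (rule fps_ext) simp

lemma fps_of_real_X [simp]: "fps_of_real fps_X = fps_X"
  by (rule fps_ext) (simp add: fps_X_def)

lemma fps_of_real_const [simp]: "fps_of_real (fps_const c) = fps_const (of_real c)"
  by (rule fps_ext) simp

lemma geom_decay_of_real [simp]: "geom_decay (fps_of_real a) \<longleftrightarrow> geom_decay a"
  by (auto intro: geom_decay_mono)

lemma geom_decay_tendsto_0:
  assumes "geom_decay a"
  shows "fps_nth a \<longlonglongrightarrow> 0"
  using summable_LIMSEQ_zero[OF geom_decay_summable_norm[OF assms]] by (rule tendsto_norm_zero_cancel)

lemma geom_decay_times_n_tendsto_0:
  assumes "geom_decay (a :: real fps)"
  shows "(\<lambda>n. real n * fps_nth a n) \<longlonglongrightarrow> 0"
proof -
  have "geom_decay (Abs_fps (\<lambda>n. real n * fps_nth a n))"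
    by (rule geom_decay_Suc_mono[OF assms, where K = 1]) (auto simp: abs_mult intro: mult_right_mono)
  moreover have "fps_nth (Abs_fps (\<lambda>n. real n * fps_nth a n)) = (\<lambda>n. real n * fps_nth a n)"
    by (simp add: fun_eq_iff)
  ultimately show ?thesis using geom_decay_tendsto_0 by metis
qed

lemma near_const_tendsto:
  assumes "geom_decay (a - fps_const c * fps_ones)"
  shows "fps_nth a \<longlonglongrightarrow> c"
proof -
  have "(\<lambda>n. fps_nth (a - fps_const c * fps_ones) n + c) \<longlonglongrightarrow> 0 + c"
    by (intro tendsto_add geom_decay_tendsto_0 assms tendsto_const)
  then show ?thesis by simp
qed

lemma fps_mult_norm_le:
  fixes a b :: "'a::real_normed_field fps"
  assumes "\<And>n. norm (fps_nth a n) \<le> fps_nth p n" "\<And>n. norm (fps_nth b n) \<le> K * fps_nth q n"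
  shows "norm (fps_nth (a * b) n) \<le> K * fps_nth (p * q) n"
proof -
  have "norm (fps_nth (a * b) n) \<le> (\<Sum>i=0..n. norm (fps_nth a i) * norm (fps_nth b (n - i)))"
    unfolding fps_mult_nth norm_mult[symmetric] by (rule norm_sum)
  also have "\<dots> \<le> (\<Sum>i=0..n. fps_nth p i * (K * fps_nth q (n - i)))"
    by (intro sum_mono mult_mono assms) (auto intro: order_trans[OF norm_ge_zero assms(1)])
  finally show ?thesis by (simp add: fps_mult_nth sum_distrib_left ac_simps)
qed

text \<open>Young's inequality for a bounded and a summable sequence. The factor \<open>L\<close> is
  kept apart so that it can carry the small parameter of a perturbation.\<close>

lemma fps_mult_bounded:
  fixes a b :: "'a::real_normed_field fps"
  assumes "\<And>n. norm (fps_nth a n) \<le> K" "\<And>n. norm (fps_nth b n) \<le> L * fps_nth q n"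
    "summable (fps_nth q)" "\<And>n. fps_nth q n \<ge> 0" "L \<ge> 0"
  shows "norm (fps_nth (a * b) n) \<le> K * L * (\<Sum>n. fps_nth q n)"
proof -
  have K: "K \<ge> 0" using order_trans[OF norm_ge_zero assms(1)] .
  have "norm (fps_nth (b * a) n) \<le> (\<Sum>i=0..n. norm (fps_nth b i) * norm (fps_nth a (n - i)))"
    unfolding fps_mult_nth norm_mult[symmetric] by (rule norm_sum)
  also have "\<dots> \<le> (\<Sum>i=0..n. (L * fps_nth q i) * K)"
    by (intro sum_mono mult_mono assms) (use assms in auto)
  also have "\<dots> = K * L * (\<Sum>i=0..n. fps_nth q i)" by (simp add: sum_distrib_left ac_simps)
  also have "\<dots> \<le> K * L * (\<Sum>n. fps_nth q n)"
    using assms K by (intro mult_left_mono sum_le_suminf) auto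
  finally show ?thesis by (simp add: mult.commute)
qed

text \<open>
  Geometric ergodicity: \<open>(1 - f) / (1 - x)\<close> has no zero in the closed unit disc, hence none in a slightly
  larger disc, so its inverse has radius of convergence larger than 1.
\<close>
theorem renewal_geometric:
  fixes f :: "real fps"
  assumes f: "geom_decay f" "fps_nth f 0 = 0" "\<And>n. fps_nth f n \<ge> 0" "(\<Sum>n. fps_nth f n) = 1"
    and aperiodic: "fps_nth f 1 > 0"
  obtains c where "c > 0" "geom_decay (inverse (1 - f) - fps_const c * fps_ones)"
proof -
  \<comment> \<open>Its coefficients are the tail sums of \<open>f\<close>: nonnegative,
    geometrically decaying, and with positive total. The zero of \<open>1 - f\<close> at 1 has been
    cancelled.\<close>
  define H where "H = (1 - f) * fps_ones"
  have Xf: "(1 - fps_X) * H = 1 - f"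
    unfolding H_def by (simp only: mult.left_commute[of "1 - fps_X"] fps_ones_mult_one_minus_X mult_1_right)
  have Hn: "fps_nth H n = 1 - (\<Sum>i\<le>n. fps_nth f i)" for n
    by (simp add: H_def left_diff_distrib fps_mult_ones_nth)
  have H: "geom_decay H"
    using geom_decay_uminus[OF geom_decay_partial_sums[OF f(1)]]
    by (simp add: H_def f(4) algebra_simps)
  have Hnn: "fps_nth H n \<ge> 0" for n
    unfolding Hn using sum_le_suminf[OF geom_decay_summable[OF f(1)], of "{..n}"] f by simp
  have Hpos: "(\<Sum>n. fps_nth H n) > 0"
    using suminf_pos2[OF geom_decay_summable[OF H] Hnn, of 0] f(2) by (simp add: Hn)
  define Hc where "Hc = fps_of_real H"
  have Hc: "fps_conv_radius Hc > 1"
    unfolding Hc_def by (intro geom_decay_imp_conv_radius_gt_1) (simp add: H)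
  define Fc where "Fc = fps_of_real f"
  have Fc: "fps_conv_radius Fc > 1"
    unfolding Fc_def by (intro geom_decay_imp_conv_radius_gt_1) (simp add: f)
  have XFc: "(1 - fps_X) * Hc = 1 - Fc"
    using arg_cong[OF Xf, of fps_of_real] by (simp add: Hc_def Fc_def fps_of_real_mult fps_of_real_diff)
  have nz: "eval_fps Hc z \<noteq> 0" if z: "norm z \<le> 1" for z
  proof (cases "z = 1")
    case True
    have "eval_fps Hc 1 = of_real (\<Sum>n. fps_nth H n)"
      by (simp add: eval_fps_def Hc_def suminf_of_real geom_decay_summable[OF H])
    then show ?thesis using Hpos True by simp
  next
    case False
    have zr: "ereal (norm z) < fps_conv_radius Hc" "ereal (norm z) < fps_conv_radius Fc"
      using z by (auto intro: le_less_trans[OF _ Hc] le_less_trans[OF _ Fc] simp: one_ereal_def)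
    have ne: "eval_fps Fc z \<noteq> 1"
    proof
      assume eq: "eval_fps Fc z = 1"
      have "(\<lambda>n. fps_nth Fc n * z ^ n) sums 1"
        using sums_eval_fps[OF zr(2)] eq by simp
      then have 1: "(\<lambda>n. Re (fps_nth Fc n * z ^ n)) sums 1"
        using sums_Re by fastforce
      \<comment> \<open>Subtracting from the total mass 1 leaves a sum of nonnegative terms with
        value 0. So the term with n = 1 vanishes, and \<open>fps_nth f 1 > 0\<close> forces
        \<open>z\<close> to be 1.\<close>
      have "(\<lambda>n. fps_nth f n - Re (fps_nth Fc n * z ^ n)) sums (1 - 1)"
        by (intro sums_diff 1) (use geom_decay_summable[OF f(1)] f(4) in \<open>simp add: sums_iff\<close>)
      then have s: "(\<lambda>n. fps_nth f n * (1 - Re (z ^ n))) sums 0"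
        by (simp add: Fc_def algebra_simps)
      have nn: "fps_nth f n * (1 - Re (z ^ n)) \<ge> 0" for n
      proof -
        have "Re (z ^ n) \<le> norm (z ^ n)" by (rule complex_Re_le_cmod)
        also have "\<dots> \<le> 1" using z by (simp add: norm_power power_le_one)
        finally show ?thesis using f(3) by simp
      qed
      have "(\<Sum>n. fps_nth f n * (1 - Re (z ^ n))) > 0 \<or> fps_nth f 1 * (1 - Re (z ^ 1)) \<le> 0"
        using suminf_pos2[OF sums_summable[OF s], of 1] nn by force
      then have "fps_nth f 1 * (1 - Re z) \<le> 0" using s by (simp add: sums_iff)
      then have "Re z \<ge> 1" using aperiodic by (simp add: mult_le_0_iff)
      moreover have "Re z ^ 2 + Im z ^ 2 \<le> 1"
        using z by (simp add: cmod_def)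
      moreover have "1 \<le> Re z ^ 2" using \<open>Re z \<ge> 1\<close> by simp
      ultimately have "Im z ^ 2 \<le> 0" by linarith
      then have "Re z = 1 \<and> Im z = 0"
        using complex_Re_le_cmod[of z] z \<open>Re z \<ge> 1\<close> by auto
      then show False using False by (simp add: complex_eq_iff)
    qed
    have "eval_fps ((1 - fps_X) * Hc) z = eval_fps (1 - fps_X) z * eval_fps Hc z"
    proof (rule eval_fps_mult)
      have "fps_conv_radius (1 - fps_X :: complex fps) \<ge> min (fps_conv_radius (1::complex fps)) (fps_conv_radius (fps_X::complex fps))"
        by (rule fps_conv_radius_diff)
      then show "ereal (norm z) < fps_conv_radius (1 - fps_X :: complex fps)"
        by (simp add: less_le_trans[of "ereal (norm z)" \<infinity>])
    qed (use zr in auto)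
    moreover have "eval_fps (1 - Fc) z = 1 - eval_fps Fc z"
      using zr by (subst eval_fps_diff) auto
    ultimately show ?thesis using ne by (auto simp: XFc)
  qed
  \<comment> \<open>The set where \<open>Hc\<close> does not vanish is open and contains the compact
    unit disc, hence also an \<open>e\<close>-neighbourhood of it. A point outside the disc is
    compared with its radial projection \<open>sgn z\<close>.\<close>
  obtain r :: real where r: "r > 1" "\<And>z. norm z < r \<Longrightarrow> eval_fps Hc z \<noteq> 0"
  proof -
    define S where "S = {z \<in> eball 0 (fps_conv_radius Hc). eval_fps Hc z \<noteq> 0}"
    have "open S"
    proof -
      have "open (eball 0 (fps_conv_radius Hc) \<inter> eval_fps Hc -` (- {0}))"
        by (intro continuous_open_preimage continuous_on_eval_fps) auto
      also have "eball 0 (fps_conv_radius Hc) \<inter> eval_fps Hc -` (- {0}) = S" by (auto simp: S_def)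
      finally show ?thesis .
    qed
    moreover have "cball 0 1 \<subseteq> S"
      using nz by (auto simp: S_def in_eball_iff intro: le_less_trans[OF _ Hc] simp: one_ereal_def)
    ultimately obtain e where e: "e > 0" "(\<Union>x\<in>cball 0 1. ball x e) \<subseteq> S"
      using compact_subset_open_imp_ball_epsilon_subset[of "cball 0 1" S] by auto
    have "eval_fps Hc z \<noteq> 0" if "norm z < 1 + e" for z
    proof -
      have "z \<in> S"
      proof (cases "norm z \<le> 1")
        case True
        then show ?thesis using \<open>cball 0 1 \<subseteq> S\<close> by auto
      next
        case False
        have "dist (sgn z) z = \<bar>1 - norm z\<bar>"
        proof -
          have "sgn z - z = of_real (1 / norm z - 1) * z"
            by (simp add: sgn_div_norm scaleR_conv_of_real algebra_simps divide_inverse)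
          then have "dist (sgn z) z = \<bar>1 / norm z - 1\<bar> * norm z" 
            by (simp only: dist_norm norm_mult norm_of_real)
          also have "\<dots> = \<bar>1 - norm z\<bar>"
            using False by (cases "z = 0") (simp_all add: abs_if field_simps)
          finally show ?thesis .
        qed
        then have "z \<in> ball (sgn z) e" using that False by auto
        moreover have "sgn z \<in> cball 0 1" by (simp add: norm_sgn)
        ultimately show ?thesis using e by blast
      qed
      then show ?thesis by (simp add: S_def)
    qed
    then show ?thesis using that[of "1 + e"] e by auto
  qed
  have "fps_conv_radius (inverse Hc) \<ge> min (ereal r) (fps_conv_radius Hc)"
    using r by (intro fps_conv_radius_inverse) auto
  moreover have "1 < min (ereal r) (fps_conv_radius Hc)"
    using r Hc by (simp add: one_ereal_def)
  ultimately have "fps_conv_radius (inverse Hc) > 1" by (rule less_le_trans[rotated])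
  then have iHc: "geom_decay (inverse Hc)" by (rule conv_radius_gt_1_imp_geom_decay)
  \<comment> \<open>The inverse was obtained over the complex numbers; since \<open>H\<close> is
    real, real parts preserve \<open>H * K = 1\<close>. Then \<open>inverse (1 - f)\<close> is
    \<open>K * fps_ones\<close>, so its coefficients are partial sums of \<open>K\<close> and
    converge to the sum of \<open>K\<close>.\<close>
  define K where "K = Abs_fps (\<lambda>n. Re (fps_nth (inverse Hc) n))"
  have K: "geom_decay K"
    by (rule geom_decay_mono[OF iHc]) (simp add: K_def abs_Re_le_cmod)
  have "Hc * inverse Hc = 1"
    using nz[of 0] by (intro inverse_mult_eq_1') (simp add: eval_fps_at_0)
  then have HK: "H * K = 1"
  proof (intro fps_ext)
    fix n
    have "fps_nth (H * K) n = Re (fps_nth (Hc * inverse Hc) n)"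
      by (simp add: fps_mult_nth K_def Hc_def)
    then show "fps_nth (H * K) n = fps_nth 1 n" using \<open>Hc * inverse Hc = 1\<close> by simp
  qed
  have "(1 - f) * (K * fps_ones) = 1"
  proof -
    have "(1 - f) * (K * fps_ones) = ((1 - fps_X) * fps_ones) * (H * K)"
      unfolding Xf[symmetric] by (simp only: ac_simps)
    then show ?thesis by (simp add: HK fps_ones_mult_one_minus_X)
  qed
  then have inv: "inverse (1 - f) = K * fps_ones" by (rule fps_inverse_unique)
  have "(\<Sum>n. fps_nth H n) * (\<Sum>n. fps_nth K n) = (\<Sum>n. fps_nth (1::real fps) n)"
    using suminf_mult_geom_decay[OF H K] by (simp add: HK)
  also have "\<dots> = 1"
    by (subst suminf_finite[of "{0}"]) auto
  finally have "(\<Sum>n. fps_nth K n) > 0" using Hpos by (metis mult_pos_neg less_eq_real_def linorder_neqE_linordered_idom mult_zero_right not_one_le_zero zero_less_one)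
  then show ?thesis
    using that[of "\<Sum>n. fps_nth K n"] geom_decay_partial_sums[OF K] by (simp add: inv)
qed

lemma near_const_bounded:
  fixes a :: "real fps"
  assumes "geom_decay (a - fps_const l * fps_ones)"
  obtains K where "\<And>n. \<bar>fps_nth a n\<bar> \<le> K"
proof -
  have "Bseq (fps_nth a)"
    using near_const_tendsto[OF assms] by (intro convergent_imp_Bseq convergentI)
  then show ?thesis using that by (elim BseqE) auto
qed

lemma tail_bound:
  assumes "\<And>n. norm (fps_nth a n) \<le> K * fps_nth q n" "geom_decay (a :: complex fps)" "geom_decay (q :: real fps)"
  shows "norm (fps_nth (fps_const (\<Sum>n. fps_nth a n) * fps_ones - a * fps_ones) n)
     \<le> K * fps_nth (fps_const (\<Sum>n. fps_nth q n) * fps_ones - q * fps_ones) n"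
proof -
  have a: "(\<Sum>k. fps_nth a k) = (\<Sum>k. fps_nth a (k + Suc n)) + (\<Sum>i<Suc n. fps_nth a i)"
    using geom_decay_summable[OF assms(2)] by (rule suminf_split_initial_segment)
  have q: "(\<Sum>k. fps_nth q k) = (\<Sum>k. fps_nth q (k + Suc n)) + (\<Sum>i<Suc n. fps_nth q i)"
    using geom_decay_summable[OF assms(3)] by (rule suminf_split_initial_segment)
  have sq: "summable (\<lambda>k. fps_nth q (k + Suc n))"
    using geom_decay_summable[OF assms(3)] by (rule summable_ignore_initial_segment)
  have sa: "summable (\<lambda>k. norm (fps_nth a (k + Suc n)))"
    using geom_decay_summable_norm[OF assms(2)] by (rule summable_ignore_initial_segment)
  have "norm (\<Sum>k. fps_nth a (k + Suc n)) \<le> (\<Sum>k. norm (fps_nth a (k + Suc n)))"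
    by (rule summable_norm[OF sa])
  also have "\<dots> \<le> (\<Sum>k. K * fps_nth q (k + Suc n))"
    by (intro suminf_le assms(1) sa summable_mult sq)
  also have "\<dots> = K * (\<Sum>k. fps_nth q (k + Suc n))"
    by (rule suminf_mult[OF sq])
  finally show ?thesis
    using a q by (simp add: fps_mult_ones_nth lessThan_Suc_atMost)
qed

section \<open>Compositions and levels of trees\<close>

text \<open>Power sums other than 1 occur because removing the zeros and lowering the other entries
  turns the power sum into a multiple of \<open>b\<close>.\<close>

definition composition_msets :: "nat \<Rightarrow> nat \<Rightarrow> nat \<Rightarrow> nat multiset set" where
  "composition_msets b N m = {M. size M = m \<and> (\<Sum>k\<in>#M. 1 / real b ^ k) = real N}"

text \<open>Times \<open>fact (size M)\<close> the coefficient is the multinomial number of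
  orderings of \<open>M\<close>. Without that global factor the weight is multiplicative over the
  levels.\<close>

definition mset_weight :: "nat multiset \<Rightarrow> real poly" where
  "mset_weight M = monom (1 / (\<Prod>x\<in>set_mset M. fact (count M x))) (card (set_mset M))"

definition composition_poly :: "nat \<Rightarrow> nat \<Rightarrow> nat \<Rightarrow> real poly" where
  "composition_poly b N m = (\<Sum>M\<in>composition_msets b N m. mset_weight M)"

lemma power_sum_pos:
  assumes "b \<ge> 2" "M \<noteq> {#}"
  shows "0 < (\<Sum>k\<in>#M. 1 / real b ^ k)"
  using assms(2)
proof (induction M)
  case (add x M)
  have "1 / real b ^ x > 0" using assms by simp
  then show ?case using add by (cases "M = {#}") (simp_all del: zero_less_divide_1_iff add: add_pos_pos)
qed simp

lemma power_sum_nonneg: "b \<ge> 2 \<Longrightarrow> 0 \<le> (\<Sum>k\<in>#M. 1 / real b ^ k)"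
  using power_sum_pos[of b M] by (cases "M = {#}") auto

lemma composition_msets_0:
  assumes "b \<ge> 2"
  shows "composition_msets b 0 m = (if m = 0 then {{#}} else {})"
proof -
  have "M = {#}" if "M \<in> composition_msets b 0 m" for M
    using power_sum_pos[OF assms, of M] that by (cases "M = {#}") (auto simp: composition_msets_def)
  moreover have "{#} \<in> composition_msets b 0 m \<longleftrightarrow> m = 0" by (auto simp: composition_msets_def)
  ultimately show ?thesis by auto
qed

lemma smult_sum_right: "smult c (\<Sum>x\<in>A. f x) = (\<Sum>x\<in>A. smult c (f x))"
  by (induction A rule: infinite_finite_induct) (auto simp: smult_add_right)

lemma finite_composition_msets:
  assumes "b \<ge> 2"
  shows "finite (composition_msets b N m)"
proof (cases "N = 0")
  case True
  then show ?thesis using assms by (simp add: composition_msets_0)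
next
  case False
  have "composition_msets b N m
      \<subseteq> mset ` {ks. length ks = m \<and> (\<Sum>k\<leftarrow>ks. 1 / real b ^ k) = real N}"
  proof
    fix M assume M: "M \<in> composition_msets b N m"
    obtain ks where "mset ks = M" using ex_mset by blast
    then show "M \<in> mset ` {ks. length ks = m \<and> (\<Sum>k\<leftarrow>ks. 1 / real b ^ k) = real N}"
      using M by (force simp: composition_msets_def image_iff simp flip: sum_mset_sum_list)
  qed
  then show ?thesis using finite_power_sum_lists[OF assms, of "real N" m] False
    by (auto intro: finite_subset)
qed

text \<open>Lists are grouped by their multiset; each fibre of \<open>mset\<close> consists of the
  orderings of one multiset, all with the same number of distinct parts.\<close>

lemma sum_compositions:
  assumes "b \<ge> 2"
  shows "(\<Sum>ks\<in>compositions b m. monom 1 (distinct_parts ks)) = smult (fact m) (composition_poly b 1 m)"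
proof -
  have img: "mset ` compositions b m \<subseteq> composition_msets b 1 m"
    by (auto simp: compositions_def composition_msets_def simp flip: sum_mset_sum_list)
  have fiber: "(\<Sum>ks | ks \<in> compositions b m \<and> mset ks = M. monom 1 (distinct_parts ks))
      = smult (fact m) (mset_weight M)" if M: "M \<in> composition_msets b 1 m" for M
  proof -
    have "{ks \<in> compositions b m. mset ks = M} = permutations_of_multiset M"
      using M by (auto simp: compositions_def composition_msets_def permutations_of_multiset_def
          simp flip: sum_mset_sum_list)
    then have "(\<Sum>ks | ks \<in> compositions b m \<and> mset ks = M. monom 1 (distinct_parts ks))
        = (\<Sum>ks\<in>permutations_of_multiset M. monom 1 (card (set_mset M)) :: real poly)"
      by (intro sum.cong) (auto simp: distinct_parts_def permutations_of_multiset_def)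
    also have "\<dots> = monom (real (card (permutations_of_multiset M))) (card (set_mset M))"
      by (simp add: of_nat_poly smult_monom)
    also have "real (card (permutations_of_multiset M))
        = fact m / (\<Prod>x\<in>set_mset M. fact (count M x))"
      using M card_permutations_of_multiset[of M]
      by (simp add: real_of_nat_div composition_msets_def)
    finally show ?thesis by (simp add: mset_weight_def smult_monom)
  qed
  have "(\<Sum>ks\<in>compositions b m. monom 1 (distinct_parts ks) :: real poly)
      = (\<Sum>M\<in>composition_msets b 1 m. \<Sum>ks | ks \<in> compositions b m \<and> mset ks = M. monom 1 (distinct_parts ks))"
    by (rule sum.group[symmetric]) (use img finite_compositions finite_composition_msets assms in auto)
  also have "\<dots> = (\<Sum>M\<in>composition_msets b 1 m. smult (fact m) (mset_weight M))"
    by (intro sum.cong fiber) auto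
  finally show ?thesis by (simp add: composition_poly_def smult_sum_right)
qed

section \<open>Recursion over the levels of a tree\<close>

definition step_weight :: "nat \<Rightarrow> nat \<Rightarrow> real poly" where
  "step_weight N t = monom (1 / fact (N - t)) (if t < N then 1 else 0)"

definition unshift :: "nat \<Rightarrow> nat multiset \<Rightarrow> nat multiset" where
  "unshift a M = replicate_mset a 0 + image_mset Suc M"

lemma count_unshift: "count (unshift a M) 0 = a" "count (unshift a M) (Suc k) = count M k"
proof -
  have "count (image_mset Suc M) (Suc k) = count M k"
    by (induction M) auto
  moreover have "count (image_mset Suc M) 0 = 0"
    by (simp add: count_eq_zero_iff)
  ultimately show "count (unshift a M) 0 = a" "count (unshift a M) (Suc k) = count M k"
    by (simp_all add: unshift_def)
qed

text \<open>The new value 0 contributes \<open>1 / fact a\<close> and is a further distinct part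
  exactly if \<open>a > 0\<close>. Hence the exponent of \<open>step_weight\<close> is 0 for a level
  without leaves.\<close>

lemma mset_weight_unshift:
  assumes "a \<le> N"
  shows "mset_weight (unshift a M) = step_weight N (N - a) * mset_weight M"
proof -
  have p: "(\<Prod>x\<in>Suc ` set_mset M. fact (count (unshift c M) x)) = (\<Prod>x\<in>set_mset M. fact (count M x) :: real)" for c
    by (subst prod.reindex) (simp_all add: count_unshift)
  have c: "card (Suc ` set_mset M) = card (set_mset M)" by (intro card_image) simp
  show ?thesis
  proof (cases "a = 0")
    case True
    have "set_mset (unshift 0 M) = Suc ` set_mset M" by (simp add: unshift_def)
    then show ?thesis
      using True by (simp add: mset_weight_def p c step_weight_def mult_monom)
  next
    case False
    then have "set_mset (unshift a M) = insert 0 (Suc ` set_mset M)" by (simp add: unshift_def)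
    then show ?thesis
      using False assms by (simp add: mset_weight_def p c count_unshift step_weight_def mult_monom)
  qed
qed

lemma size_unshift: "size (unshift a M) = a + size M"
  by (simp add: unshift_def)

lemma sum_unshift:
  "(\<Sum>k\<in>#unshift a M. 1 / real b ^ k) = real a + (\<Sum>k\<in>#M. 1 / real b ^ k) / real b"
proof -
  have "(\<Sum>k\<in>#M. 1 / real b ^ Suc k) = (\<Sum>k\<in>#M. 1 / real b ^ k) / real b"
    by (induction M) (auto simp: add_divide_distrib)
  then show ?thesis by (simp add: unshift_def image_mset.compositionality o_def)
qed

definition shift :: "nat multiset \<Rightarrow> nat multiset" where
  "shift M = image_mset (\<lambda>k. k - 1) (filter_mset (\<lambda>k. k \<noteq> 0) M)"

lemma shift_unshift: "shift (unshift a M) = M"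
proof -
  have "filter_mset (\<lambda>k. k \<noteq> 0) (image_mset Suc M) = image_mset Suc M"
    by (induction M) auto
  then show ?thesis by (simp add: shift_def unshift_def image_mset.compositionality o_def)
qed

lemma unshift_shift: "unshift (count M 0) (shift M) = M"
proof -
  have "image_mset Suc (shift M) = filter_mset (\<lambda>k. k \<noteq> 0) M"
    by (induction M) (auto simp: shift_def)
  moreover have "replicate_mset (count M 0) 0 = filter_mset (\<lambda>k. \<not> k \<noteq> 0) M"
    by (simp add: filter_eq_replicate_mset)
  ultimately show ?thesis
    unfolding unshift_def by (metis multiset_partition union_commute)
qed

text \<open>Splitting off the zeros: the other entries, lowered by 1, have power sum \<open>b t\<close>, where \<open>N - t\<close> is the number of zeros.\<close>
lemma composition_poly_rec:
  assumes b: "b \<ge> 2"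
  shows "composition_poly b N m
     = (\<Sum>t\<in>{t. t \<le> N \<and> N - t \<le> m}. step_weight N t * composition_poly b (b * t) (m - (N - t)))"
proof -
  let ?T = "{t. t \<le> N \<and> N - t \<le> m}"
  have fin: "finite ?T" by (rule finite_subset[of _ "{..N}"]) auto
  have "(\<Sum>t\<in>?T. step_weight N t * composition_poly b (b * t) (m - (N - t)))
      = (\<Sum>(t, M)\<in>(SIGMA t:?T. composition_msets b (b * t) (m - (N - t))). step_weight N t * mset_weight M)"
    by (subst sum.Sigma[symmetric]) (use fin b in \<open>auto simp: composition_poly_def sum_distrib_left finite_composition_msets\<close>)
  also have "\<dots> = (\<Sum>M\<in>composition_msets b N m. mset_weight M)"
  proof (rule sum.reindex_bij_witness[where j = "\<lambda>(t, M). unshift (N - t) M" and i = "\<lambda>M. (N - count M 0, shift M)"], goal_cases)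
    case (1 x)
    then show ?case by (auto simp: shift_unshift count_unshift)
  next
    case (2 x)
    then show ?case using b mset_weight_unshift[of "N - fst x" N "snd x"]
      by (auto simp: composition_msets_def size_unshift sum_unshift of_nat_diff)
  next
    case (3 M)
    have M: "size M = m" "(\<Sum>k\<in>#M. 1 / real b ^ k) = real N" using 3 by (auto simp: composition_msets_def)
    have s: "real (count M 0) + (\<Sum>k\<in>#shift M. 1 / real b ^ k) / real b = real N"
      using sum_unshift[where a = "count M 0" and M = "shift M" and b = b] M by (simp add: unshift_shift)
    have "(\<Sum>k\<in>#shift M. 1 / real b ^ k) \<ge> 0" by (rule power_sum_nonneg[OF b])
    then have "(\<Sum>k\<in>#shift M. 1 / real b ^ k) / real b \<ge> 0" by simp
    with s have "count M 0 \<le> N" by linarith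
    then show ?case by (simp add: unshift_shift)
  next
    case (4 M)
    have M: "size M = m" "(\<Sum>k\<in>#M. 1 / real b ^ k) = real N" using 4 by (auto simp: composition_msets_def)
    have s: "real (count M 0) + (\<Sum>k\<in>#shift M. 1 / real b ^ k) / real b = real N"
      using sum_unshift[where a = "count M 0" and M = "shift M" and b = b] M by (simp add: unshift_shift)
    have "(\<Sum>k\<in>#shift M. 1 / real b ^ k) \<ge> 0" by (rule power_sum_nonneg[OF b])
    then have "(\<Sum>k\<in>#shift M. 1 / real b ^ k) / real b \<ge> 0" by simp
    with s have "count M 0 \<le> N" by linarith
    moreover have "m = count M 0 + size (shift M)"
      using size_unshift[of "count M 0" "shift M"] M by (simp add: unshift_shift)
    moreover have "(\<Sum>k\<in>#shift M. 1 / real b ^ k) = real b * (real N - real (count M 0))"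
      using s b by (simp add: field_simps)
    ultimately show ?case by (auto simp: composition_msets_def of_nat_diff)
  next
    case (5 x)
    then show ?case using mset_weight_unshift[of "N - fst x" N "snd x"] by auto
  qed
  finally show ?thesis by (simp add: composition_poly_def)
qed

text \<open>Every summand is at most 1, so a power sum \<open>N\<close> takes at least
  \<open>N\<close> parts.\<close>

lemma composition_poly_less:
  assumes "b \<ge> 2" "m < N"
  shows "composition_poly b N m = 0"
proof -
  have *: "(\<Sum>k\<in>#M. 1 / real b ^ k) \<le> real (size M)" for M :: "nat multiset"
  proof (induction M)
    case (add x M)
    have "1 / real b ^ x \<le> 1" using assms by (simp add: divide_le_eq)
    then show ?case using add by simp
  qed simp
  have "M \<notin> composition_msets b N m" for M
    using *[of M] assms by (auto simp: composition_msets_def)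
  then have "composition_msets b N m = {}" by blast
  then show ?thesis by (simp add: composition_poly_def)
qed

lemma composition_poly_0:
  assumes "b \<ge> 2"
  shows "composition_poly b 0 m = (if m = 0 then 1 else 0)"
  using assms by (auto simp: composition_poly_def composition_msets_0 mset_weight_def monom_0 one_pCons)

text \<open>The state \<open>s\<close> has \<open>b * s\<close> children, and \<open>n\<close>
  counts the inner vertices below. Each of these replaces one leaf by \<open>b\<close> leaves, which
  explains the number \<open>b * s + (b - 1) * n\<close> of parts.\<close>

definition level_poly :: "nat \<Rightarrow> nat \<Rightarrow> nat \<Rightarrow> real poly" where
  "level_poly b s n = composition_poly b (b * s) (b * s + (b - 1) * n)"

lemma level_poly_rec:
  assumes b: "b \<ge> 2"
  shows "level_poly b s n = (if n = 0 then step_weight (b * s) 0 else 0)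
     + (\<Sum>t=1..min (b * s) n. step_weight (b * s) t * level_poly b t (n - t))"
proof -
  let ?N = "b * s" and ?m = "b * s + (b - 1) * n"
  let ?h = "\<lambda>t. step_weight ?N t * composition_poly b (b * t) (?m - (?N - t))"
  have "{t. t \<le> ?N \<and> ?N - t \<le> ?m} = {..?N}" by auto
  then have "level_poly b s n = (\<Sum>t\<le>?N. ?h t)"
    unfolding level_poly_def by (subst composition_poly_rec[OF b]) simp
  also have "\<dots> = ?h 0 + (\<Sum>t=1..?N. ?h t)"
    by (simp add: sum.atMost_shift sum.atLeast1_atMost_eq lessThan_atLeast0)
  also have "?h 0 = (if n = 0 then step_weight ?N 0 else 0)"
    using b by (simp add: composition_poly_0)
  \<comment> \<open>For \<open>t > n\<close> fewer than \<open>b * t\<close> parts would remain, too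
    few for the power sum \<open>b * t\<close>.\<close>
  also have "(\<Sum>t=1..?N. ?h t) = (\<Sum>t=1..min ?N n. ?h t)"
  proof (rule sum.mono_neutral_right)
    show "\<forall>t\<in>{1..?N} - {1..min ?N n}. ?h t = 0"
    proof
      fix t assume t: "t \<in> {1..?N} - {1..min ?N n}"
      then have "n < t" "t \<le> ?N" by auto
      have "(b - 1) * n < (b - 1) * t" using b \<open>n < t\<close> by simp
      then have "?m - (?N - t) < b * t" using \<open>t \<le> ?N\<close> b by (cases b) auto
      then show "?h t = 0" using composition_poly_less[OF b] by simp
    qed
  qed auto
  also have "\<dots> = (\<Sum>t=1..min ?N n. step_weight ?N t * level_poly b t (n - t))"
  proof (rule sum.cong[OF refl])
    fix t assume t: "t \<in> {1..min ?N n}"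
    then obtain k where k: "n = t + k" using le_Suc_ex by auto
    obtain c where c: "b = Suc c" using b by (cases b) auto
    have "?m - (?N - t) = b * t + (b - 1) * (n - t)"
      using t unfolding k by (simp add: c algebra_simps)
    then show "?h t = step_weight ?N t * level_poly b t (n - t)" by (simp add: level_poly_def)
  qed
  finally show ?thesis .
qed

text \<open>Split off the root. As a leaf (\<open>t = 0\<close>) it would leave power sum 0 with a
  positive number of parts; as an inner vertex (\<open>t = 1\<close>) it has step weight 1. The root
  itself is not counted by \<open>n\<close>, hence \<open>Suc n\<close>.\<close>

lemma sum_compositions_level_poly:
  assumes b: "b \<ge> 2"
  shows "(\<Sum>ks\<in>compositions b ((b - 1) * Suc n + 1). monom 1 (distinct_parts ks))
    = smult (fact ((b - 1) * Suc n + 1)) (level_poly b 1 n)"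
proof -
  have "{t. t \<le> (1::nat) \<and> 1 - t \<le> (b - 1) * Suc n + 1} = {0, 1}" by auto
  then have "composition_poly b 1 ((b - 1) * Suc n + 1) = level_poly b 1 n"
    using b by (subst composition_poly_rec[OF b])
      (auto simp: composition_poly_0 level_poly_def step_weight_def monom_0 one_pCons)
  then show ?thesis by (simp only: sum_compositions[OF b])
qed

section \<open>Excursions avoiding the state 1\<close>

text \<open>
  \<open>passage_poly b j s n\<close> is meant for \<open>j \<le> 1\<close>: the weight of the paths from \<open>s\<close> that end at their first
  visit to \<open>j\<close> and have only states \<open>\<ge> 2\<close> in between, where \<open>n\<close> is the sum of the states after \<open>s\<close>.
\<close>
function passage_poly :: "nat \<Rightarrow> nat \<Rightarrow> nat \<Rightarrow> nat \<Rightarrow> real poly" where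
  "passage_poly b j s n = (if n = j then step_weight (b * s) j else 0)
     + (\<Sum>t=2..min (b * s) n. step_weight (b * s) t * passage_poly b j t (n - t))"
  by pat_completeness auto
termination by (relation "Wellfounded.measure (\<lambda>(b, j, s, n). n)") auto

declare passage_poly.simps [simp del]

text \<open>Decomposition at the first visit to 1: a path to 0 either avoids 1 or reaches it first
  after length \<open>k\<close> and then continues as a fresh path from 1. The induction removes the
  first step, with \<open>t = 1\<close> as an immediate visit.\<close>

lemma level_poly_renewal:
  assumes b: "b \<ge> 2" and "s \<ge> 1"
  shows "level_poly b s n = passage_poly b 0 s n
    + (\<Sum>k\<le>n. passage_poly b 1 s k * level_poly b 1 (n - k))"
  using assms(2)
proof (induction n arbitrary: s rule: less_induct)
  case (less n)
  let ?N = "b * s" and ?W = "step_weight (b * s)" and ?L = "level_poly b 1"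
  have N: "?N \<ge> 1" using less.prems b by simp
  have IH: "level_poly b t (n - t) = passage_poly b 0 t (n - t)
      + (\<Sum>k\<le>n - t. passage_poly b 1 t k * ?L (n - t - k))" if "t \<in> {2..min ?N n}" for t
    using that by (intro less.IH) auto
  have "(\<Sum>k\<le>n. passage_poly b 1 s k * ?L (n - k))
      = (\<Sum>k\<le>n. (if k = 1 then ?W 1 * ?L (n - 1) else 0))
       + (\<Sum>k\<le>n. \<Sum>t=2..min ?N k. ?W t * passage_poly b 1 t (k - t) * ?L (n - k))"
    unfolding sum.distrib[symmetric]
    by (intro sum.cong refl, subst passage_poly.simps) (simp add: distrib_right sum_distrib_right)
  also have "(\<Sum>k\<le>n. (if k = 1 then ?W 1 * ?L (n - 1) else 0))
      = (if n \<ge> 1 then ?W 1 * ?L (n - 1) else 0)" by (simp add: sum.delta)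
  also have "(\<Sum>k\<le>n. \<Sum>t=2..min ?N k. ?W t * passage_poly b 1 t (k - t) * ?L (n - k))
      = (\<Sum>k\<in>{..n}. \<Sum>t | t \<in> {2..min ?N n} \<and> t \<le> k. ?W t * passage_poly b 1 t (k - t) * ?L (n - k))"
    by (intro sum.cong) auto
  also have "\<dots> = (\<Sum>t\<in>{2..min ?N n}. \<Sum>k | k \<in> {..n} \<and> t \<le> k. ?W t * passage_poly b 1 t (k - t) * ?L (n - k))"
    by (rule sum.swap_restrict) auto
  also have "\<dots> = (\<Sum>t=2..min ?N n. ?W t * (\<Sum>k\<le>n - t. passage_poly b 1 t k * ?L (n - t - k)))"
  proof (rule sum.cong[OF refl])
    fix t assume t: "t \<in> {2..min ?N n}"
    have "(\<Sum>k | k \<in> {..n} \<and> t \<le> k. ?W t * passage_poly b 1 t (k - t) * ?L (n - k))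
        = (\<Sum>k\<le>n - t. ?W t * passage_poly b 1 t k * ?L (n - t - k))"
      by (rule sum.reindex_bij_witness[where i = "\<lambda>k. k + t" and j = "\<lambda>k. k - t"]) (use t in auto)
    then show "(\<Sum>k | k \<in> {..n} \<and> t \<le> k. ?W t * passage_poly b 1 t (k - t) * ?L (n - k))
        = ?W t * (\<Sum>k\<le>n - t. passage_poly b 1 t k * ?L (n - t - k))"
      by (simp add: sum_distrib_left mult.assoc)
  qed
  finally have conv: "(\<Sum>k\<le>n. passage_poly b 1 s k * ?L (n - k))
      = (if n \<ge> 1 then ?W 1 * ?L (n - 1) else 0)
       + (\<Sum>t=2..min ?N n. ?W t * (\<Sum>k\<le>n - t. passage_poly b 1 t k * ?L (n - t - k)))" .
  have "(\<Sum>t=1..min ?N n. ?W t * level_poly b t (n - t))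
      = (if n \<ge> 1 then ?W 1 * ?L (n - 1) else 0) + (\<Sum>t=2..min ?N n. ?W t * level_poly b t (n - t))"
    using N by (cases "n \<ge> 1") (simp_all add: sum.atLeast_Suc_atMost numeral_2_eq_2)
  also have "(\<Sum>t=2..min ?N n. ?W t * level_poly b t (n - t))
     = (\<Sum>t=2..min ?N n. ?W t * passage_poly b 0 t (n - t))
       + (\<Sum>t=2..min ?N n. ?W t * (\<Sum>k\<le>n - t. passage_poly b 1 t k * ?L (n - t - k)))"
    unfolding sum.distrib[symmetric] by (intro sum.cong refl, subst IH) (auto simp: distrib_left)
  finally show ?case
    unfolding conv by (subst level_poly_rec[OF b], subst passage_poly.simps) simp
qed

lemma degree_step_weight: "degree (step_weight N t) \<le> 1"
  unfolding step_weight_def by (rule order_trans[OF degree_monom_le]) auto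

text \<open>Each step scores at most 1 and uses up at least 1 of the length, except a final step to
  0; hence \<open>Suc n\<close>. The reward being bounded linearly in the length, moments of it
  inherit geometric tails.\<close>

lemma degree_passage_poly: "degree (passage_poly b j s n) \<le> Suc n"
proof (induction n arbitrary: s rule: less_induct)
  case (less n)
  have "degree (step_weight (b * s) t * passage_poly b j t (n - t)) \<le> Suc n"
    if t: "t \<in> {2..min (b * s) n}" for t
  proof -
    have "degree (passage_poly b j t (n - t)) \<le> Suc (n - t)" using t by (intro less.IH) auto
    then show ?thesis
      using degree_mult_le[of "step_weight (b * s) t" "passage_poly b j t (n - t)"]
        degree_step_weight[of "b * s" t] t by (simp only: atLeastAtMost_iff) linarith
  qed
  moreover have "degree (if n = j then step_weight (b * s) j else 0) \<le> Suc n"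
    using degree_step_weight[of "b * s" j] by auto
  ultimately show ?case
    by (subst passage_poly.simps) (intro degree_add_le degree_sum_le, auto)
qed

lemma coeff_step_weight_nonneg: "coeff (step_weight N t) i \<ge> 0"
  by (simp add: step_weight_def)

lemma coeff_mult_nonneg:
  fixes p q :: "real poly"
  assumes "\<And>i. coeff p i \<ge> 0" "\<And>i. coeff q i \<ge> 0"
  shows "coeff (p * q) i \<ge> 0"
  unfolding coeff_mult by (intro sum_nonneg mult_nonneg_nonneg assms)

lemma coeff_passage_poly_nonneg: "coeff (passage_poly b j s n) i \<ge> 0"
proof (induction n arbitrary: s i rule: less_induct)
  case (less n)
  have "coeff (step_weight (b * s) t * passage_poly b j t (n - t)) i \<ge> 0"
    if t: "t \<in> {2..min (b * s) n}" for t
    using t by (intro coeff_mult_nonneg coeff_step_weight_nonneg less.IH) auto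
  moreover have "coeff (if n = j then step_weight (b * s) j else 0) i \<ge> 0"
    using coeff_step_weight_nonneg by auto
  ultimately show ?case
    by (subst passage_poly.simps) (auto simp: coeff_sum intro!: add_nonneg_nonneg sum_nonneg)
qed

lemma poly_passage_poly_nonneg: "poly (passage_poly b j s n) 1 \<ge> 0"
  by (simp add: poly_altdef sum_nonneg coeff_passage_poly_nonneg)

lemma poly_step_weight [simp]: "poly (step_weight N t) 1 = 1 / fact (N - t)"
  by (simp add: step_weight_def poly_monom)

text \<open>By superharmonicity of \<open>h\<close>, the weighted paths from a state
  \<open>t >= 2\<close> to \<open>j\<close> total at most \<open>h t / h j\<close>. The start
  \<open>s\<close> may be 1, where superharmonicity is not assumed, so the bound is the one-step sum
  instead of \<open>h s / h j\<close>. Truncation at \<open>N\<close> makes the induction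
  possible.\<close>

lemma passage_sum_bound:
  fixes x :: real and h :: "nat \<Rightarrow> real"
  assumes b: "b \<ge> 2" and x: "x > 0" and h: "\<And>t. h t \<ge> 0" and hj: "h j > 0" and j: "j \<le> 1"
    and super: "\<And>s. s \<ge> 2 \<Longrightarrow> (\<Sum>t\<le>b * s. x ^ t * h t / fact (b * s - t)) \<le> h s"
    and s: "s \<ge> 1"
  shows "(\<Sum>n\<le>N. poly (passage_poly b j s n) 1 * x ^ n)
     \<le> (\<Sum>t\<le>b * s. x ^ t * h t / fact (b * s - t)) / h j"
  using s
proof (induction N arbitrary: s rule: less_induct)
  case (less N)
  let ?P = "\<lambda>s n. poly (passage_poly b j s n) 1"
  have Pnn: "?P s n \<ge> 0" for s n by (rule poly_passage_poly_nonneg)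
  have "(\<Sum>n\<le>N. ?P s n * x ^ n)
     = (\<Sum>n\<le>N. (if n = j then x ^ j / fact (b * s - j) else 0))
     + (\<Sum>n\<le>N. \<Sum>t | t \<in> {2..b * s} \<and> t \<le> n. x ^ t / fact (b * s - t) * (?P t (n - t) * x ^ (n - t)))"
    unfolding sum.distrib[symmetric]
  proof (intro sum.cong refl)
    fix n
    have rec: "?P s n = (if n = j then 1 / fact (b * s - j) else 0)
       + (\<Sum>t=2..min (b * s) n. 1 / fact (b * s - t) * ?P t (n - t))"
      by (subst passage_poly.simps) (simp add: poly_sum)
    have "(\<Sum>t=2..min (b * s) n. 1 / fact (b * s - t) * ?P t (n - t)) * x ^ n
      = (\<Sum>t=2..min (b * s) n. x ^ t / fact (b * s - t) * (?P t (n - t) * x ^ (n - t)))"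
      unfolding sum_distrib_right
    proof (intro sum.cong refl)
      fix t assume "t \<in> {2..min (b * s) n}"
      then have "x ^ n = x ^ t * x ^ (n - t)" by (simp flip: power_add)
      then show "1 / fact (b * s - t) * ?P t (n - t) * x ^ n
         = x ^ t / fact (b * s - t) * (?P t (n - t) * x ^ (n - t))" by simp
    qed
    also have "\<dots> = (\<Sum>t | t \<in> {2..b * s} \<and> t \<le> n. x ^ t / fact (b * s - t) * (?P t (n - t) * x ^ (n - t)))"
      by (intro sum.cong) auto
    finally show "?P s n * x ^ n = (if n = j then x ^ j / fact (b * s - j) else 0)
       + (\<Sum>t | t \<in> {2..b * s} \<and> t \<le> n. x ^ t / fact (b * s - t) * (?P t (n - t) * x ^ (n - t)))"
      by (subst rec) (simp add: distrib_right)
  qed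
  moreover have "(\<Sum>n\<le>N. \<Sum>t | t \<in> {2..b * s} \<and> t \<le> n. x ^ t / fact (b * s - t) * (?P t (n - t) * x ^ (n - t)))
     = (\<Sum>t\<in>{2..b * s}. \<Sum>n | n \<in> {..N} \<and> t \<le> n. x ^ t / fact (b * s - t) * (?P t (n - t) * x ^ (n - t)))"
    by (rule sum.swap_restrict) auto
  moreover have "(\<Sum>t\<in>{2..b * s}. \<Sum>n | n \<in> {..N} \<and> t \<le> n. x ^ t / fact (b * s - t) * (?P t (n - t) * x ^ (n - t)))
     \<le> (\<Sum>t\<in>{2..b * s}. x ^ t / fact (b * s - t) * (h t / h j))"
  proof (intro sum_mono)
    fix t assume t: "t \<in> {2..b * s}"
    have "(\<Sum>n | n \<in> {..N} \<and> t \<le> n. ?P t (n - t) * x ^ (n - t)) \<le> h t / h j"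
    proof (cases "t \<le> N")
      case True
      have "(\<Sum>n | n \<in> {..N} \<and> t \<le> n. ?P t (n - t) * x ^ (n - t)) = (\<Sum>n\<le>N - t. ?P t n * x ^ n)"
        by (rule sum.reindex_bij_witness[where i = "\<lambda>k. k + t" and j = "\<lambda>k. k - t"]) (use True in auto)
      also have "\<dots> \<le> (\<Sum>u\<le>b * t. x ^ u * h u / fact (b * t - u)) / h j"
        using t True by (intro less.IH) auto
      also have "\<dots> \<le> h t / h j"
        using t hj by (intro divide_right_mono super) auto
      finally show ?thesis .
    next
      case False
      then have "{n. n \<in> {..N} \<and> t \<le> n} = {}" by auto
      then show ?thesis using h hj by (simp only:) simp
    qed
    then show "(\<Sum>n | n \<in> {..N} \<and> t \<le> n. x ^ t / fact (b * s - t) * (?P t (n - t) * x ^ (n - t)))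
       \<le> x ^ t / fact (b * s - t) * (h t / h j)"
      unfolding sum_distrib_left[symmetric] using x by (intro mult_left_mono) auto
  qed
  moreover have "(\<Sum>n\<le>N. (if n = j then x ^ j / fact (b * s - j) else 0)) \<le> x ^ j / fact (b * s - j) * (h j / h j)"
  proof -
    have "0 \<le> x ^ j / fact (b * s - j)" using x by simp
    moreover have "(\<Sum>n\<le>N. (if n = j then x ^ j / fact (b * s - j) else 0))
        = (if j \<le> N then x ^ j / fact (b * s - j) else 0)" by (subst sum.delta) auto
    ultimately show ?thesis using hj by (simp split: if_splits)
  qed
  moreover have "x ^ j / fact (b * s - j) * (h j / h j) + (\<Sum>t\<in>{2..b * s}. x ^ t / fact (b * s - t) * (h t / h j))
     = (\<Sum>t\<in>insert j {2..b * s}. x ^ t / fact (b * s - t) * (h t / h j))"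
    using j by (subst sum.insert) auto
  moreover have "(\<Sum>t\<in>insert j {2..b * s}. x ^ t / fact (b * s - t) * (h t / h j))
     \<le> (\<Sum>t\<le>b * s. x ^ t / fact (b * s - t) * (h t / h j))"
  proof (rule sum_mono2)
    have "b * s \<ge> 1" using b less.prems by simp
    with j have "j \<le> b * s" by linarith
    then show "insert j {2..b * s} \<subseteq> {..b * s}" by auto
  qed (use x h hj in auto)
  moreover have "(\<Sum>t\<le>b * s. x ^ t / fact (b * s - t) * (h t / h j))
     = (\<Sum>t\<le>b * s. x ^ t * h t / fact (b * s - t)) / h j"
    unfolding sum_divide_distrib by (intro sum.cong) auto
  ultimately show ?case by linarith
qed

text \<open>A crude Stirling bound: from \<open>n\<close> to \<open>n + 1\<close> the right-hand
  side grows by at least the factor \<open>n + 1\<close>, by Bernoulli's inequality and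
  \<open>e <= 4\<close>. It places the point \<open>x\<close> used for \<open>b >= 3\<close> above
  \<open>fact (b - 1)\<close>.\<close>

lemma fact_le_power_exp:
  assumes "n \<ge> 2"
  shows "fact n \<le> (2 * real n / exp 1) ^ n"
  using assms
proof (induction n rule: dec_induct)
  case base
  \<comment> \<open>The start amounts to \<open>e ^ 2 <= 8\<close>, which needs a numerical bound on
    e.\<close>
  have "exp (1::real) ^ 2 \<le> (272 / 100) ^ 2"
    using e_less_272 by (intro power_mono) auto
  then show ?case by (simp add: power_divide field_simps power2_eq_square)
next
  case (step n)
  have "- 1 \<le> 1 / real n" by (rule order_trans[of _ 0]) auto
  then have "2 \<le> (1 + 1 / real n) ^ n"
    using Bernoulli_inequality[of "1 / real n" n] step by simp
  also have "1 + 1 / real n = real (Suc n) / real n" using step by (simp add: field_simps)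
  finally have B: "2 \<le> (real (Suc n) / real n) ^ n" .
  have e: "exp (1::real) \<le> 4" using e_less_272 by simp
  have "fact (Suc n) = real (Suc n) * fact n" by simp
  also have "\<dots> \<le> real (Suc n) * (2 * real n / exp 1) ^ n"
    using step by (intro mult_left_mono) auto
  also have "\<dots> \<le> (4 / exp 1) * (real (Suc n) * (2 * real n / exp 1) ^ n)"
    using e mult_right_mono[of 1 "4 / exp 1" "real (Suc n) * (2 * real n / exp 1) ^ n"] by simp
  also have "\<dots> = (2 * real (Suc n) / exp 1) * (2 * (2 * real n / exp 1) ^ n)" by simp
  also have "\<dots> \<le> (2 * real (Suc n) / exp 1) * ((real (Suc n) / real n) ^ n * (2 * real n / exp 1) ^ n)"
    using B by (intro mult_left_mono mult_right_mono) auto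
  also have "(real (Suc n) / real n) ^ n * (2 * real n / exp 1) ^ n = (2 * real (Suc n) / exp 1) ^ n"
  proof -
    have "(real (Suc n) / real n) * (2 * real n / exp 1) = 2 * real (Suc n) / exp 1"
      using step by simp
    then show ?thesis by (simp only: power_mult_distrib[symmetric])
  qed
  finally show ?case by simp
qed

text \<open>
  With \<open>x = y\<^sup>b\<^sup>-\<^sup>1\<close> the sum is at most \<open>exp (e y)\<close> times a power, and it is \<open>e y = 2 (b - 1) \<le> s (b - 1)\<close> that makes
  it small enough. For \<open>b = 2\<close> this \<open>x\<close> would be below \<open>(b - 1)!\<close>, so that case needs another function.
\<close>
lemma superharmonic_ge_3:
  assumes b: "b \<ge> 3" and s: "s \<ge> 2"
  defines "y \<equiv> 2 * real (b - 1) / exp 1"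
  shows "(\<Sum>t\<le>b * s. (y ^ (b - 1)) ^ t * (1 / (exp 1 * y ^ b)) ^ t / fact (b * s - t))
    \<le> (1 / (exp 1 * y ^ b)) ^ s"
proof -
  have y: "y > 0" using b by (simp add: y_def)
  have yb: "y ^ b = y * y ^ (b - 1)" using b by (cases b) auto
  define z where "z = exp 1 * y"
  have z: "z > 0" using y by (simp add: z_def)
  have zb: "z = 2 * real (b - 1)" by (simp add: z_def y_def)
  \<comment> \<open>The tilt and the superharmonic function combine to a power of
    \<open>1 / z\<close>; reversing the sum leaves a truncated exponential series in
    \<open>z\<close>.\<close>
  have "y ^ (b - 1) * (1 / (exp 1 * y ^ b)) = 1 / z"
    using y by (simp add: yb z_def)
  then have "(\<Sum>t\<le>b * s. (y ^ (b - 1)) ^ t * (1 / (exp 1 * y ^ b)) ^ t / fact (b * s - t))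
     = (\<Sum>t\<le>b * s. (1 / z) ^ t / fact (b * s - t))"
    by (simp flip: power_mult_distrib)
  also have "\<dots> = (\<Sum>t\<le>b * s. (1 / z) ^ (b * s - t) / fact t)"
    by (rule sum.reindex_bij_witness[where i = "\<lambda>t. b * s - t" and j = "\<lambda>t. b * s - t"]) auto
  also have "\<dots> = (1 / z) ^ (b * s) * (\<Sum>t\<le>b * s. z ^ t /\<^sub>R fact t)"
    unfolding sum_distrib_left
  proof (intro sum.cong refl)
    fix t assume "t \<in> {..b * s}"
    then have "z ^ (b * s) = z ^ (b * s - t) * z ^ t" by (simp flip: power_add)
    then show "(1 / z) ^ (b * s - t) / fact t = (1 / z) ^ (b * s) * (z ^ t /\<^sub>R fact t)"
      using z by (simp add: field_simps)
  qed
  also have "(\<Sum>t\<le>b * s. z ^ t /\<^sub>R fact t) \<le> exp z"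
    unfolding exp_def using z by (intro sum_le_suminf summable_exp_generic) auto
  also have "exp z \<le> exp (real (b - 1) * real s)"
    unfolding zb using s mult_right_mono[of 2 "real s" "real (b - 1)"] by (simp add: mult.commute)
  also have "exp (real (b - 1) * real s) = (exp 1 ^ (b - 1)) ^ s"
    by (simp flip: exp_of_nat_mult)
  also have "(1 / z) ^ (b * s) * (exp 1 ^ (b - 1)) ^ s = ((1 / z) ^ b * exp 1 ^ (b - 1)) ^ s"
    by (simp add: power_mult power_mult_distrib)
  also have "(1 / z) ^ b * exp 1 ^ (b - 1) = 1 / (exp 1 * y ^ b)"
  proof -
    have "exp (1::real) ^ b = exp 1 * exp 1 ^ (b - 1)" using b by (cases b) auto
    then show ?thesis using y by (simp add: z_def power_mult_distrib power_divide)
  qed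
  finally show ?thesis using z by simp
qed

text \<open>The choice \<open>1 / fact t\<close> turns the sum into a row of binomial coefficients,
  \<open>4 ^ s / fact (2 * s)\<close>, which is at most \<open>1 / fact s\<close> from
  \<open>s = 3\<close> on. At \<open>s = 2\<close> this fails (2/3 against 1/2), so the values at 0
  and 1 are lowered; 1/5 gives exact equality there.\<close>

lemma superharmonic_2:
  assumes s: "s \<ge> 2"
  defines "h \<equiv> \<lambda>t. if t \<le> 1 then 1 / 5 else 1 / fact t :: real"
  shows "(\<Sum>t\<le>2 * s. 1 ^ t * h t / fact (2 * s - t)) \<le> h s"
proof (cases "s = 2")
  case True
  then show ?thesis by (simp add: h_def eval_nat_numeral fact_numeral)
next
  case False
  then have s3: "s \<ge> 3" using s by simp
  have "(\<Sum>t\<le>2 * s. 1 ^ t * h t / fact (2 * s - t)) \<le> (\<Sum>t\<le>2 * s. real (2 * s choose t) / fact (2 * s))"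
  proof (intro sum_mono)
    fix t assume t: "t \<in> {..2 * s}"
    have "h t \<le> 1 / fact t" by (cases t) (auto simp: h_def)
    then have "1 ^ t * h t / fact (2 * s - t) \<le> 1 / fact t / fact (2 * s - t)"
      using divide_right_mono[of "h t" "1 / fact t" "fact (2 * s - t)"] by simp
    also have "\<dots> = real (2 * s choose t) / fact (2 * s)"
      using t by (simp add: binomial_fact)
    finally show "1 ^ t * h t / fact (2 * s - t) \<le> real (2 * s choose t) / fact (2 * s)" .
  qed
  also have "\<dots> = 4 ^ s / fact (2 * s)"
    using choose_row_sum[of "2 * s"] 
    by (simp flip: sum_divide_distrib of_nat_sum add: power_mult)
  also have "\<dots> \<le> 1 / fact s"
  proof -
    have "4 ^ s * fact s \<le> (fact (2 * s) :: real)"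
      using s3
    proof (induction s rule: dec_induct)
      case base
      then show ?case by (simp add: fact_numeral)
    next
      case (step n)
      have "4 ^ Suc n * fact (Suc n) = (4 * (real n + 1)) * (4 ^ n * fact n)" by simp
      also have "\<dots> \<le> ((2 * real n + 2) * (2 * real n + 1)) * fact (2 * n)"
        using step by (intro mult_mono) (auto simp: algebra_simps)
      also have "\<dots> = fact (2 * Suc n)" by (simp add: algebra_simps)
      finally show ?case .
    qed
    then show ?thesis by (simp add: field_simps)
  qed
  finally show ?thesis using s by (simp add: h_def)
qed

lemma superharmonic_exists:
  assumes b: "b \<ge> 2"
  obtains x :: real and h :: "nat \<Rightarrow> real" where
    "x \<ge> fact (b - 1)" "\<And>t. h t > 0"
    "\<And>s. s \<ge> 2 \<Longrightarrow> (\<Sum>t\<le>b * s. x ^ t * h t / fact (b * s - t)) \<le> h s"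
proof (cases "b = 2")
  case True
  show ?thesis
    by (rule that[of 1 "\<lambda>t. if t \<le> 1 then 1 / 5 else 1 / fact t"]) (use True superharmonic_2 in auto)
next
  case False
  then have b3: "b \<ge> 3" using b by simp
  let ?y = "2 * real (b - 1) / exp 1"
  show ?thesis
  proof (rule that[of "?y ^ (b - 1)" "\<lambda>t. (1 / (exp 1 * ?y ^ b)) ^ t"])
    show "fact (b - 1) \<le> ?y ^ (b - 1)" using b3 by (intro fact_le_power_exp) auto
  qed (use superharmonic_ge_3 b3 in auto)
qed

text \<open>Intermediate values on \<open>[0, x]\<close>, where the series converges uniformly. That
  \<open>r\<close> lies strictly below \<open>x\<close> is what later yields geometric
  tails.\<close>

lemma power_series_solution:
  fixes f :: "nat \<Rightarrow> real"
  assumes f: "\<And>k. f k \<ge> 0" "f 0 = 0" and x: "x > 0" and sm: "summable (\<lambda>k. f k * x ^ k)"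
    and gt: "(\<Sum>k. f k * x ^ k) > 1"
  obtains r where "0 < r" "r < x" "(\<Sum>k. f k * r ^ k) = 1"
proof -
  let ?F = "\<lambda>z. \<Sum>k. f k * z ^ k"
  have "uniform_limit {0..x} (\<lambda>n z. \<Sum>k<n. f k * z ^ k) ?F sequentially"
    by (rule Weierstrass_m_test[OF _ sm]) (use f x in \<open>auto intro!: mult_left_mono power_mono\<close>)
  then have "continuous_on {0..x} ?F"
    by (rule uniform_limit_theorem[rotated]) (auto intro!: always_eventually continuous_intros)
  moreover have "?F 0 = 0" using f(2) by (subst suminf_finite[of "{}"]) (auto simp: power_0_left)
  ultimately obtain r where r: "0 \<le> r" "r \<le> x" "?F r = 1"
    using IVT'[of ?F 0 1 x] gt x by auto
  have "r \<noteq> 0" using r \<open>?F 0 = 0\<close> by (metis zero_neq_one)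
  moreover have "r \<noteq> x" using r gt by auto
  ultimately show ?thesis using r by (intro that[of r]) auto
qed

section \<open>Short cycles and the choice of the tilt\<close>

lemma coeff_passage_poly_1: "b \<ge> 2 \<Longrightarrow> coeff (passage_poly b 1 1 1) 1 = 1 / fact (b - 1)"
  by (subst passage_poly.simps) (simp add: step_weight_def)

text \<open>The cycle 1 -> 2 -> 1 has length 3. Its first step leaves a leaf only if
  \<open>b > 2\<close>, its second step always does; so its reward \<open>d\<close> is 2 or
  1.\<close>

lemma coeff_passage_poly_3:
  assumes "b \<ge> 2"
  obtains d where "d < 3" "coeff (passage_poly b 1 1 3) d > 0"
proof -
  define d :: nat where "d = (if 2 < b then 2 else 1)"
  have p: "passage_poly b 1 2 1 = step_weight (b * 2) 1"
    by (subst passage_poly.simps) simp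
  have "0 < coeff (step_weight b 2 * passage_poly b 1 2 1) d"
    unfolding p using assms by (auto simp: step_weight_def mult_monom d_def)
  also have "\<dots> \<le> (\<Sum>t=2..min b 3. coeff (step_weight b t * passage_poly b 1 t (3 - t)) d)"
    using member_le_sum[of 2 "{2..min b 3}" "\<lambda>t. coeff (step_weight b t * passage_poly b 1 t (3 - t)) d"] assms
    by (simp add: coeff_mult_nonneg coeff_step_weight_nonneg coeff_passage_poly_nonneg)
  also have "\<dots> = coeff (passage_poly b 1 1 3) d"
    by (subst (2) passage_poly.simps) (simp add: coeff_sum)
  finally show ?thesis by (intro that[of d]) (auto simp: d_def)
qed

lemma passage_poly_1_0: "passage_poly b 1 s 0 = 0"
  by (subst passage_poly.simps) simp

lemma passage_growth:
  assumes b: "b \<ge> 2"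
  obtains r :: real where "r > 0"
    "\<And>j. j \<le> 1 \<Longrightarrow> geom_decay (Abs_fps (\<lambda>n. poly (passage_poly b j 1 n) 1 * r ^ n))"
    "(\<Sum>n. poly (passage_poly b 1 1 n) 1 * r ^ n) = 1"
proof -
  obtain x :: real and h where x: "x \<ge> fact (b - 1)" "\<And>t. h t > 0"
    "\<And>s. s \<ge> 2 \<Longrightarrow> (\<Sum>t\<le>b * s. x ^ t * h t / fact (b * s - t)) \<le> h s"
    using superharmonic_exists[OF b] by blast
  have x0: "x > 0" using x(1) by (rule less_le_trans[rotated]) simp
  let ?P = "\<lambda>j n. poly (passage_poly b j 1 n) 1"
  have nn: "?P j n \<ge> 0" for j n by (rule poly_passage_poly_nonneg)
  have sm: "summable (\<lambda>n. ?P j n * x ^ n)" if "j \<le> 1" for j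
  proof (rule summableI_nonneg_bounded)
    fix n
    have "(\<Sum>i<n. ?P j i * x ^ i) \<le> (\<Sum>i\<le>n. ?P j i * x ^ i)"
      using nn x0 by (intro sum_mono2) auto
    also have "\<dots> \<le> (\<Sum>t\<le>b * 1. x ^ t * h t / fact (b * 1 - t)) / h j"
      by (rule passage_sum_bound) (use b x x0 that in \<open>auto intro: less_imp_le\<close>)
    finally show "(\<Sum>i<n. ?P j i * x ^ i) \<le> (\<Sum>t\<le>b * 1. x ^ t * h t / fact (b * 1 - t)) / h j" .
  qed (use nn x0 in auto)
  have gt: "(\<Sum>n. ?P 1 n * x ^ n) > 1"
  proof -
    have "1 / fact (b - 1) \<le> ?P 1 1"
      by (subst passage_poly.simps) (use b in simp)
    then have "1 \<le> ?P 1 1 * x ^ 1"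
      using mult_mono[of "1 / fact (b - 1)" "?P 1 1" "fact (b - 1)" x] x(1) nn[of 1 1] by simp
    moreover obtain d where d: "coeff (passage_poly b 1 1 3) d > 0"
      using coeff_passage_poly_3[OF b] by blast
    then have "coeff (passage_poly b 1 1 3) d \<le> ?P 1 3"
      unfolding poly_altdef
      using member_le_sum[of d "{..degree (passage_poly b 1 1 3)}" "coeff (passage_poly b 1 1 3)"]
        coeff_passage_poly_nonneg le_degree[of "passage_poly b 1 1 3" d] by simp
    with d have "0 < ?P 1 3 * x ^ 3" using x0 by simp
    ultimately have "1 < (\<Sum>n\<in>{1, 3}. ?P 1 n * x ^ n)" by simp
    also have "\<dots> \<le> (\<Sum>n. ?P 1 n * x ^ n)"
      using nn x0 by (intro sum_le_suminf sm) auto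
    finally show ?thesis .
  qed
  obtain r where r: "0 < r" "r < x" "(\<Sum>n. ?P 1 n * r ^ n) = 1"
  proof (rule power_series_solution[of "?P 1" x])
    show "?P 1 0 = 0" by (simp only: passage_poly_1_0 poly_0)
  qed (use nn x0 sm[of 1] gt in auto)
  \<comment> \<open>A term of the convergent series at \<open>x\<close> is at most its sum, so
    passing from \<open>x\<close> to \<open>r\<close> leaves the ratio \<open>r / x\<close>.\<close>
  have "geom_decay (Abs_fps (\<lambda>n. ?P j n * r ^ n))" if "j \<le> 1" for j
  proof (rule geom_decayI)
    show "0 < r / x" "r / x < 1" using r x0 by auto
    fix n
    have "?P j n * x ^ n \<le> (\<Sum>n. ?P j n * x ^ n)"
      using sum_le_suminf[OF sm[OF that], of "{n}"] nn x0 by simp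
    then have "?P j n * x ^ n * (r / x) ^ n \<le> (\<Sum>n. ?P j n * x ^ n) * (r / x) ^ n"
      using r x0 by (intro mult_right_mono) auto
    then show "norm (fps_nth (Abs_fps (\<lambda>n. ?P j n * r ^ n)) n) \<le> (\<Sum>n. ?P j n * x ^ n) * (r / x) ^ n"
      using nn[of j n] r x0 by (simp add: power_divide)
  qed
  then show ?thesis using r by (intro that[of r]) auto
qed

section \<open>Renewal equations for polynomials\<close>

text \<open>The linear map sending the monomial of degree \<open>i\<close> to \<open>g i\<close>.
  For nonnegative coefficients it is the unnormalised expectation of \<open>g\<close> at the random
  reward, so moments and characteristic functions are both values of it.\<close>

definition lin :: "(nat \<Rightarrow> 'a::real_vector) \<Rightarrow> real poly \<Rightarrow> 'a" where
  "lin g p = (\<Sum>i\<le>degree p. coeff p i *\<^sub>R g i)"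

lemma lin_altdef:
  assumes "degree p \<le> N"
  shows "lin g p = (\<Sum>i\<le>N. coeff p i *\<^sub>R g i)"
  unfolding lin_def by (rule sum.mono_neutral_left) (use assms in \<open>auto simp: coeff_eq_0\<close>)

lemma lin_0 [simp]: "lin g 0 = 0"
  by (simp add: lin_def)

lemma lin_add: "lin g (p + q) = lin g p + lin g q"
proof -
  define N where "N = max (degree p) (degree q)"
  have "degree (p + q) \<le> N" "degree p \<le> N" "degree q \<le> N"
    by (auto simp: N_def degree_add_le)
  then show ?thesis by (simp add: lin_altdef scaleR_add_left sum.distrib)
qed

lemma lin_smult: "lin g (smult c p) = c *\<^sub>R lin g p"
  using degree_smult_le[of c p] by (simp add: lin_altdef[of _ "degree p"] scaleR_sum_right)

lemma lin_sum: "lin g (\<Sum>x\<in>A. p x) = (\<Sum>x\<in>A. lin g (p x))"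
  by (induction A rule: infinite_finite_induct) (auto simp: lin_add)

lemma lin_monom: "lin g (monom c d) = c *\<^sub>R g d"
proof -
  have "lin g (monom c d) = (\<Sum>i\<le>d. coeff (monom c d) i *\<^sub>R g i)"
    by (rule lin_altdef) (rule degree_monom_le)
  also have "\<dots> = (\<Sum>i\<le>d. if i = d then c *\<^sub>R g i else 0)" by (intro sum.cong) auto
  finally show ?thesis by simp
qed

lemma lin_pCons: "lin g (pCons a p) = a *\<^sub>R g 0 + lin (\<lambda>i. g (Suc i)) p"
proof -
  have "lin g (pCons a p) = (\<Sum>i\<le>Suc (degree p). coeff (pCons a p) i *\<^sub>R g i)"
    by (rule lin_altdef) (rule degree_pCons_le)
  then show ?thesis by (simp add: sum.atMost_Suc_shift lin_def del: sum.atMost_Suc)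
qed

lemma lin_mult: "lin g (p * q) = lin (\<lambda>i. lin (\<lambda>j. g (i + j)) q) p"
  by (induction p arbitrary: g) (simp_all add: lin_add lin_smult lin_pCons)

lemma lin_fun_add: "lin (\<lambda>i. g i + h i) p = lin g p + lin h p"
  by (simp add: lin_def scaleR_add_right sum.distrib)

lemma lin_fun_diff: "lin (\<lambda>i. g i - h i) p = lin g p - lin h p"
  by (simp add: lin_def scaleR_diff_right sum_subtractf)

lemma lin_fun_mult_right: "lin (\<lambda>i. g i * c) p = lin g p * (c::'a::real_algebra)"
  by (simp add: lin_def sum_distrib_right)

lemma lin_fun_mult_left: "lin (\<lambda>i. c * g i) p = (c::'a::real_algebra) * lin g p"
  by (simp add: lin_def sum_distrib_left)

lemma lin_const: "lin (\<lambda>_. c) p = lin (\<lambda>_. 1) p * (c::'a::real_algebra_1)"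
  using lin_fun_mult_right[of "\<lambda>_. 1" c p] by simp

lemma lin_of_real: "lin (\<lambda>i. of_real (g i)) p = (of_real (lin g p) :: 'a::real_algebra_1)"
  by (simp add: lin_def scaleR_conv_of_real)

lemma poly_1_eq_lin: "poly p 1 = lin (\<lambda>_. 1) p"
  by (simp add: poly_altdef lin_def)

lemma norm_lin_le:
  assumes "\<And>i. coeff p i \<ge> 0" "\<And>i. i \<le> degree p \<Longrightarrow> norm (g i) \<le> M"
  shows "norm (lin g p) \<le> M * lin (\<lambda>_. 1) p"
proof -
  have "norm (lin g p) \<le> (\<Sum>i\<le>degree p. norm (coeff p i *\<^sub>R g i))"
    unfolding lin_def by (rule norm_sum)
  also have "\<dots> \<le> (\<Sum>i\<le>degree p. M * coeff p i)"
    using assms by (intro sum_mono) (simp add: mult.commute[of M] mult_left_mono)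
  finally show ?thesis by (simp add: lin_def sum_distrib_left)
qed

text \<open>The discrete Volterra equation \<open>x\<^sub>n = A - z (x\<^sub>0 + \<dots> + x\<^sub>n)\<close> has the solution \<open>A / (1 + z)\<^sup>n\<^sup>+\<^sup>1\<close>.\<close>
lemma volterra_perturbation:
  fixes x :: "nat \<Rightarrow> complex" and z :: complex
  assumes z: "Re z \<ge> 0" and \<eta>: "\<And>n. norm (x n - (A - z * (\<Sum>j\<le>n. x j))) \<le> \<eta> n"
  shows "norm (x n - A * (1 / (1 + z)) ^ Suc n) \<le> \<eta> n + norm z * (\<Sum>j\<le>n. \<eta> j)"
proof -
  have nz: "1 + z \<noteq> 0" using z by (auto simp: complex_eq_iff)
  have le1: "norm (1 / (1 + z)) \<le> 1"
  proof -
    have "1 \<le> Re (1 + z)" using z by simp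
    also have "\<dots> \<le> norm (1 + z)" by (rule complex_Re_le_cmod)
    finally show ?thesis by (simp add: norm_divide divide_le_eq)
  qed
  \<comment> \<open>The exact right-hand side. Unlike \<open>x\<close> it obeys a one-step recursion
    in which only the error is left over, and since \<open>1 / (1 + z)\<close> has norm at most 1,
    the errors merely add up.\<close>
  define w where "w n = A - z * (\<Sum>j\<le>n. x j)" for n
  have w: "norm (w n - A * (1 / (1 + z)) ^ Suc n) \<le> norm z * (\<Sum>j\<le>n. \<eta> j)" for n
  proof (induction n)
    case 0
    define d where "d = x 0 - w 0"
    have "w 0 = (A - z * d) / (1 + z)" using nz by (simp add: w_def d_def field_simps)
    then have "w 0 - A * (1 / (1 + z)) ^ Suc 0 = (1 / (1 + z)) * (- z * d)"
      by (simp add: diff_divide_distrib)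
    then have "norm (w 0 - A * (1 / (1 + z)) ^ Suc 0) = norm (1 / (1 + z)) * (norm z * norm d)"
      by (simp only: norm_mult norm_minus_cancel)
    also have "\<dots> \<le> 1 * (norm z * \<eta> 0)"
      using \<eta>[of 0] le1 by (intro mult_mono) (auto simp: w_def d_def)
    finally show ?case by simp
  next
    case (Suc n)
    have "w (Suc n) = w n - z * x (Suc n)" by (simp add: w_def algebra_simps)
    define d where "d = x (Suc n) - w (Suc n)"
    have "w (Suc n) * (1 + z) = w n - z * d"
      using \<open>w (Suc n) = w n - z * x (Suc n)\<close> by (simp add: d_def algebra_simps)
    then have "w (Suc n) = (w n - z * d) / (1 + z)"
      using nz by (simp add: eq_divide_eq)
    then have "w (Suc n) - A * (1 / (1 + z)) ^ Suc (Suc n)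
        = (1 / (1 + z)) * ((w n - A * (1 / (1 + z)) ^ Suc n) - z * d)"
      by (simp add: algebra_simps diff_divide_distrib)
    then have "norm (w (Suc n) - A * (1 / (1 + z)) ^ Suc (Suc n))
        = norm (1 / (1 + z)) * norm ((w n - A * (1 / (1 + z)) ^ Suc n) - z * d)"
      by (simp only: norm_mult)
    also have "\<dots> \<le> 1 * (norm z * (\<Sum>j\<le>n. \<eta> j) + norm z * \<eta> (Suc n))"
    proof (intro mult_mono le1)
      have "norm z * norm d \<le> norm z * \<eta> (Suc n)"
        using \<eta>[of "Suc n"] by (intro mult_left_mono) (auto simp: w_def d_def)
      then show "norm ((w n - A * (1 / (1 + z)) ^ Suc n) - z * d)
         \<le> norm z * (\<Sum>j\<le>n. \<eta> j) + norm z * \<eta> (Suc n)"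
        using Suc by (intro order_trans[OF norm_triangle_ineq4[of "w n - A * (1 / (1 + z)) ^ Suc n" "z * d"]] add_mono)
            (simp_all add: norm_mult)
    qed auto
    finally show ?case by (simp add: distrib_left)
  qed
  have "norm (x n - w n) \<le> \<eta> n" using \<eta> by (simp add: w_def)
  then show ?thesis using norm_triangle_mono[OF _ w[of n], of "x n - w n" "\<eta> n"] by simp
qed

text \<open>In the unit disc, n-th powers differ by at most \<open>n\<close> times the difference of
  the bases. The bases are compared through \<open>1 / (1 + y)\<close>, which is within
  \<open>y^2\<close> of \<open>exp (- y)\<close>.\<close>

lemma power_inverse_exp_diff:
  fixes z :: complex and y :: real
  assumes z: "Re z \<ge> 0" and y: "y \<ge> 0"
  shows "norm ((1 / (1 + z)) ^ n - of_real (exp (- y * real n))) \<le> real n * (norm (z - of_real y) + y\<^sup>2)"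
proof -
  have ge1: "1 \<le> norm (1 + w)" if "Re w \<ge> 0" for w :: complex
    using complex_Re_le_cmod[of "1 + w"] that by simp
  have nz: "1 + w \<noteq> 0" if "Re w \<ge> 0" for w :: complex using ge1[OF that] by auto
  have 1: "norm (1 / (1 + z) - 1 / (1 + of_real y)) \<le> norm (z - of_real y)"
  proof -
    have "1 / (1 + z) - 1 / (1 + of_real y) = (of_real y - z) / ((1 + z) * (1 + of_real y))"
      using nz[of z] nz[of "of_real y"] z y by (simp add: field_simps)
    then have "norm (1 / (1 + z) - 1 / (1 + of_real y))
        = norm (z - of_real y) / (norm (1 + z) * norm (1 + of_real y :: complex))"
      by (simp add: norm_divide norm_mult norm_minus_commute)
    also have "\<dots> \<le> norm (z - of_real y) / 1"
    proof (rule divide_left_mono)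
      show "1 \<le> norm (1 + z) * norm (1 + of_real y :: complex)"
        using mult_mono[OF ge1[OF z] ge1[of "of_real y"]] y by simp
      show "0 < norm (1 + z) * norm (1 + of_real y :: complex) * 1"
        using nz[of z] nz[of "of_real y"] z y by simp
    qed auto
    finally show ?thesis by simp
  qed
  have 2: "norm (1 / (1 + of_real y) - of_real (exp (- y)) :: complex) \<le> y\<^sup>2"
  proof -
    have a: "exp (- y) \<le> 1 / (1 + y)"
      using exp_ge_add_one_self[of y] y by (simp add: exp_minus field_simps)
    have b: "1 - y \<le> exp (- y)" using exp_ge_add_one_self[of "- y"] by simp
    have "1 / (1 + y) - (1 - y) = y\<^sup>2 / (1 + y)" using y by (simp add: field_simps power2_eq_square)
    also have "\<dots> \<le> y\<^sup>2" using y by (simp add: divide_le_eq algebra_simps)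
    finally have "\<bar>1 / (1 + y) - exp (- y)\<bar> \<le> y\<^sup>2" using a b by linarith
    moreover have "1 / (1 + of_real y) - of_real (exp (- y)) = (of_real (1 / (1 + y) - exp (- y)) :: complex)"
      by simp
    ultimately show ?thesis by (simp only: norm_of_real)
  qed
  have 3: "norm (1 / (1 + z)) \<le> 1" using ge1[OF z] by (simp add: norm_divide divide_le_eq)
  have 4: "norm (of_real (exp (- y)) :: complex) \<le> 1" using y by simp
  have "of_real (exp (- y * real n)) = (of_real (exp (- y)) ^ n :: complex)"
    using exp_of_nat_mult[of n "- y"] by (simp add: mult.commute flip: of_real_power)
  then have "norm ((1 / (1 + z)) ^ n - of_real (exp (- y * real n)))
      \<le> real n * norm (1 / (1 + z) - of_real (exp (- y)))"
    using norm_power_diff[OF 3 4, of n] by simp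
  also have "\<dots> \<le> real n * (norm (z - of_real y) + y\<^sup>2)"
  proof (rule mult_left_mono)
    have "1 / (1 + z) - of_real (exp (- y))
        = (1 / (1 + z) - 1 / (1 + of_real y)) + (1 / (1 + of_real y) - of_real (exp (- y)))" by simp
    then show "norm (1 / (1 + z) - of_real (exp (- y))) \<le> norm (z - of_real y) + y\<^sup>2"
      using norm_triangle_mono[OF 1 2] by simp
  qed simp
  finally show ?thesis .
qed

text \<open>
  \<open>f n\<close> and \<open>e n\<close> are the weights of the cycles and of the final excursions of length \<open>n\<close>, graded by the
  reward; \<open>r\<close> is the tilt that turns the cycle weights into a probability distribution.
\<close>
locale renewal_polys =
  fixes f e u :: "nat \<Rightarrow> real poly" and r :: real
  assumes r: "r > 0"
    and f_nonneg: "\<And>n i. coeff (f n) i \<ge> 0" and e_nonneg: "\<And>n i. coeff (e n) i \<ge> 0"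
    and f_degree: "\<And>n. degree (f n) \<le> Suc n" and e_degree: "\<And>n. degree (e n) \<le> Suc n"
    and f_0: "f 0 = 0"
    and u_rec: "\<And>n. u n = e n + (\<Sum>k\<le>n. f k * u (n - k))"
    and f_decay: "geom_decay (Abs_fps (\<lambda>n. poly (f n) 1 * r ^ n))"
    and e_decay: "geom_decay (Abs_fps (\<lambda>n. poly (e n) 1 * r ^ n))"
    and f_sum: "(\<Sum>n. poly (f n) 1 * r ^ n) = 1"
    and f_1: "coeff (f 1) 1 > 0"
    and nondegenerate: "\<exists>k d. coeff (f k) d > 0 \<and> d \<noteq> k"
    and e_nonzero: "\<exists>k. poly (e k) 1 > 0"
begin

text \<open>A tilted generating function in the length. The test function sees the length as well as
  the reward, because the reward is centred by a multiple of the length.\<close>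

definition gf :: "(nat \<Rightarrow> nat \<Rightarrow> 'a::real_normed_field) \<Rightarrow> (nat \<Rightarrow> real poly) \<Rightarrow> 'a fps" where
  "gf g p = Abs_fps (\<lambda>n. lin (g n) (p n) * of_real r ^ n)"

lemma gf_nth: "fps_nth (gf g p) n = lin (g n) (p n) * of_real r ^ n"
  by (simp add: gf_def)

lemma u_nonneg: "coeff (u n) i \<ge> 0"
proof (induction n arbitrary: i rule: less_induct)
  case (less n)
  have "coeff (f k * u (n - k)) i \<ge> 0" if "k \<le> n" for k
  proof (cases "k = 0")
    case False
    then show ?thesis unfolding coeff_mult using that less
      by (intro sum_nonneg mult_nonneg_nonneg f_nonneg less.IH) auto
  qed (simp add: f_0)
  then show ?case
    by (subst u_rec) (auto simp: coeff_sum intro!: add_nonneg_nonneg e_nonneg sum_nonneg)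
qed

text \<open>The hypothesis is an addition formula for \<open>g\<close> when paths are joined; each
  product in it becomes one convolution. The index set \<open>J\<close> lets one lemma serve for
  total weights, both moments and characteristic functions.\<close>

lemma gf_renewal:
  assumes "\<And>k l p q. lin (g (k + l)) (p * q) = (\<Sum>j\<in>J. lin (a j k) p * lin (b j l) q)"
  shows "gf g u = gf g e + (\<Sum>j\<in>J. gf (a j) f * gf (b j) u)"
proof (rule fps_ext)
  fix n
  have "lin (g n) (f k * u (n - k)) * of_real r ^ n
      = (\<Sum>j\<in>J. (lin (a j k) (f k) * of_real r ^ k) * (lin (b j (n - k)) (u (n - k)) * of_real r ^ (n - k)))"
    if "k \<le> n" for k
  proof -
    have "of_real r ^ n = (of_real r ^ k * of_real r ^ (n - k) :: 'a)"
      using that by (simp flip: power_add)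
    then show ?thesis
      using assms[of k "n - k" "f k" "u (n - k)"] that by (simp add: sum_distrib_left sum_distrib_right ac_simps)
  qed
  then have "lin (g n) (u n) * of_real r ^ n = lin (g n) (e n) * of_real r ^ n
      + (\<Sum>k\<le>n. \<Sum>j\<in>J. (lin (a j k) (f k) * of_real r ^ k) * (lin (b j (n - k)) (u (n - k)) * of_real r ^ (n - k)))"
    by (subst u_rec) (simp add: lin_add lin_sum distrib_right sum_distrib_right)
  then show "fps_nth (gf g u) n = fps_nth (gf g e + (\<Sum>j\<in>J. gf (a j) f * gf (b j) u)) n"
    by (simp add: gf_nth fps_sum_nth fps_mult_nth atLeast0AtMost sum.swap[of _ J])
qed

abbreviation tot :: "nat \<Rightarrow> nat \<Rightarrow> real" where "tot \<equiv> \<lambda>_ _. 1"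

definition m :: real where "m = (\<Sum>n. real n * fps_nth (gf tot f) n)"
text \<open>Mean reward of a cycle divided by its mean length, as in the renewal reward
  theorem.\<close>

definition \<mu> :: real where "\<mu> = (\<Sum>n. fps_nth (gf (\<lambda>_ i. real i) f) n) / m"
definition dev :: "nat \<Rightarrow> nat \<Rightarrow> real" where "dev n i = real i - \<mu> * real n"
definition L :: real where "L = 1 + \<bar>\<mu>\<bar>"

lemma L: "L \<ge> 1" by (simp add: L_def)

lemma dev_add: "dev (k + l) (i + j) = dev k i + dev l j"
  by (simp add: dev_def algebra_simps)

lemma abs_dev_le: "i \<le> Suc n \<Longrightarrow> \<bar>dev n i\<bar> \<le> L * real (Suc n)"
proof -
  assume "i \<le> Suc n"
  have "\<bar>dev n i\<bar> \<le> real i + \<bar>\<mu>\<bar> * real n"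
    using abs_triangle_ineq4[of "real i" "\<mu> * real n"] by (simp add: dev_def abs_mult)
  also have "\<dots> \<le> real (Suc n) + \<bar>\<mu>\<bar> * real (Suc n)"
    using \<open>i \<le> Suc n\<close> by (intro add_mono mult_left_mono) auto
  finally show ?thesis by (simp add: L_def algebra_simps)
qed

text \<open>Shared by \<open>f\<close> and \<open>e\<close>. The total weights of \<open>u\<close>
  do not decay; they converge to a positive limit.\<close>

definition admissible :: "(nat \<Rightarrow> real poly) \<Rightarrow> bool" where
  "admissible p \<longleftrightarrow> (\<forall>n i. coeff (p n) i \<ge> 0) \<and> (\<forall>n. degree (p n) \<le> Suc n) \<and> geom_decay (gf tot p)"

lemma admissible_f: "admissible f" and admissible_e: "admissible e"
  using f_nonneg e_nonneg f_degree e_degree f_decay e_decay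
  by (simp_all add: admissible_def gf_def poly_1_eq_lin)

lemma tot_nonneg: "(\<And>n i. coeff (p n) i \<ge> 0) \<Longrightarrow> fps_nth (gf tot p) n \<ge> 0"
  using r by (auto simp: gf_nth lin_def intro!: mult_nonneg_nonneg sum_nonneg)

lemma gf_norm_le:
  fixes g :: "nat \<Rightarrow> nat \<Rightarrow> 'a::real_normed_field"
  assumes p: "admissible p" and g: "\<And>n i. i \<le> Suc n \<Longrightarrow> norm (g n i) \<le> K * real (Suc n) ^ j"
  shows "norm (fps_nth (gf g p) n) \<le> K * (real (Suc n) ^ j * fps_nth (gf tot p) n)"
proof -
  have "norm (lin (g n) (p n)) \<le> (K * real (Suc n) ^ j) * lin (\<lambda>_. 1) (p n)"
    using p unfolding admissible_def by (intro norm_lin_le g) (auto intro: order_trans)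
  then have "norm (lin (g n) (p n)) * r ^ n \<le> ((K * real (Suc n) ^ j) * lin (\<lambda>_. 1) (p n)) * r ^ n"
    using r by (intro mult_right_mono) auto
  then show ?thesis using r by (simp add: gf_nth norm_mult norm_power mult.assoc)
qed

lemma gf_decay:
  fixes g :: "nat \<Rightarrow> nat \<Rightarrow> 'a::real_normed_field"
  assumes p: "admissible p" and g: "\<And>n i. i \<le> Suc n \<Longrightarrow> norm (g n i) \<le> K * real (Suc n) ^ j"
  shows "geom_decay (gf g p)"
proof (rule geom_decay_pow_mono[where K = K])
  show "geom_decay (gf tot p)" using p by (simp add: admissible_def)
  fix n
  show "norm (fps_nth (gf g p) n) \<le> K * real (Suc n) ^ j * norm (fps_nth (gf tot p) n)"
    using gf_norm_le[where g = g, OF p g, of n] tot_nonneg[of p n] p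
    by (simp add: admissible_def mult.assoc)
qed

text \<open>A majorant that does not involve the argument of the characteristic function, so that
  estimates become uniform in it.\<close>

definition wdecay :: "nat \<Rightarrow> (nat \<Rightarrow> real poly) \<Rightarrow> real fps" where
  "wdecay j p = Abs_fps (\<lambda>n. real (Suc n) ^ j * fps_nth (gf tot p) n)"

lemma wdecay_decay: "admissible p \<Longrightarrow> geom_decay (wdecay j p)"
  by (rule geom_decay_pow_mono[of "gf tot p" _ 1 j]) (auto simp: wdecay_def admissible_def abs_mult)

lemma wdecay_nonneg: "admissible p \<Longrightarrow> fps_nth (wdecay j p) n \<ge> 0"
  by (simp add: wdecay_def admissible_def tot_nonneg)

section \<open>Asymptotics of the first two moments\<close>

abbreviation "F0 \<equiv> gf tot f"
abbreviation "U0 \<equiv> gf tot u"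
abbreviation "F1 \<equiv> gf dev f"
abbreviation "U1 \<equiv> gf dev u"
abbreviation "F2 \<equiv> gf (\<lambda>n i. (dev n i)\<^sup>2) f"
abbreviation "U2 \<equiv> gf (\<lambda>n i. (dev n i)\<^sup>2) u"

lemma F0_decay: "geom_decay F0" and E0_decay: "geom_decay (gf tot e)"
  using admissible_f admissible_e by (simp_all add: admissible_def)

lemma dev_decay: "admissible p \<Longrightarrow> geom_decay (gf dev p)"
  by (rule gf_decay[where K = L and j = 1]) (use abs_dev_le in auto)

lemma dev2_decay: "admissible p \<Longrightarrow> geom_decay (gf (\<lambda>n i. (dev n i)\<^sup>2) p)"
proof (rule gf_decay[where K = "L\<^sup>2" and j = 2])
  fix n i :: nat assume "i \<le> Suc n"
  then have "\<bar>dev n i\<bar>\<^sup>2 \<le> (L * real (Suc n))\<^sup>2" by (intro power_mono abs_dev_le) auto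
  then show "norm ((dev n i)\<^sup>2) \<le> L\<^sup>2 * real (Suc n) ^ 2" by (simp add: power_mult_distrib)
qed auto

lemma F0_at_0: "fps_nth F0 0 = 0" by (simp add: gf_nth f_0)

lemma F0_sum: "(\<Sum>n. fps_nth F0 n) = 1"
  using f_sum by (simp add: gf_nth poly_1_eq_lin)

lemma F0_at_1: "fps_nth F0 1 > 0"
proof -
  have "1 \<le> degree (f 1)" using f_1 by (intro le_degree) auto
  then have "coeff (f 1) 1 \<le> lin (\<lambda>_. 1) (f 1)"
    unfolding lin_def using member_le_sum[of 1 "{..degree (f 1)}" "coeff (f 1)"] f_nonneg by simp
  then show ?thesis using f_1 r by (simp add: gf_nth)
qed

lemma m_pos: "m > 0"
proof -
  have sm: "summable (\<lambda>n. real n * fps_nth F0 n)"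
  proof -
    have "geom_decay (Abs_fps (\<lambda>n. real n * fps_nth F0 n))"
      by (rule geom_decay_Suc_mono[OF F0_decay, where K = 1]) (auto simp: abs_mult intro: mult_right_mono)
    from geom_decay_summable_norm[OF this] show ?thesis
      using tot_nonneg f_nonneg by (simp add: abs_mult)
  qed
  have "(\<Sum>n. real n * fps_nth F0 n) > 0"
    by (rule suminf_pos2[OF sm, of 1]) (use F0_at_1 tot_nonneg[of f] f_nonneg in auto)
  then show ?thesis by (simp add: m_def)
qed

lemma F1_sum: "(\<Sum>n. fps_nth F1 n) = 0"
proof -
  have d: "geom_decay (gf (\<lambda>_ i. real i) f)"
    by (rule gf_decay[OF admissible_f, where K = 1 and j = 1]) auto
  have d2: "geom_decay (Abs_fps (\<lambda>n. real n * fps_nth F0 n))"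
    by (rule geom_decay_Suc_mono[OF F0_decay, where K = 1]) (auto simp: abs_mult intro: mult_right_mono)
  have F1n: "fps_nth F1 n = fps_nth (gf (\<lambda>_ i. real i) f) n - \<mu> * (real n * fps_nth F0 n)" for n
  proof -
    have "lin (\<lambda>_. \<mu> * real n) (f n) = lin (\<lambda>_. 1) (f n) * (\<mu> * real n)" by (rule lin_const)
    then have "lin (dev n) (f n) = lin real (f n) - \<mu> * real n * lin (\<lambda>_. 1) (f n)"
      by (simp add: dev_def[abs_def] lin_fun_diff)
    then have "lin (dev n) (f n) * r ^ n = (lin real (f n) - \<mu> * real n * lin (\<lambda>_. 1) (f n)) * r ^ n" by simp
    then show ?thesis by (simp add: gf_nth algebra_simps)
  qed
  have F1: "fps_nth F1 = (\<lambda>n. fps_nth (gf (\<lambda>_ i. real i) f) n - \<mu> * (real n * fps_nth F0 n))"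
    by (rule ext, rule F1n)
  have d2': "summable (\<lambda>n. real n * fps_nth F0 n)"
    using geom_decay_summable[OF d2] unfolding fps_nth_Abs_fps .
  have "(\<lambda>n. fps_nth (gf (\<lambda>_ i. real i) f) n - \<mu> * (real n * fps_nth F0 n))
      sums ((\<Sum>n. fps_nth (gf (\<lambda>_ i. real i) f) n) - \<mu> * m)"
    unfolding m_def
    by (rule sums_diff[OF summable_sums[OF geom_decay_summable[OF d]] sums_mult[OF summable_sums[OF d2']]])
  moreover have "\<mu> * m = (\<Sum>n. fps_nth (gf (\<lambda>_ i. real i) f) n)"
    using m_pos by (simp add: \<mu>_def)
  ultimately show ?thesis unfolding F1[symmetric] by (metis diff_self sums_unique)
qed

definition v :: real where "v = (\<Sum>n. fps_nth F2 n)"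

lemma F2_nonneg: "fps_nth F2 n \<ge> 0"
  using r f_nonneg by (auto simp: gf_nth lin_def intro!: mult_nonneg_nonneg sum_nonneg)

text \<open>If \<open>dev\<close> vanished on all cycles, the cycle of length 1 and reward 1 would
  force \<open>\<mu> = 1\<close>, and then every cycle would have reward equal to its length,
  against \<open>nondegenerate\<close>.\<close>

lemma v_pos: "v > 0"
proof -
  have ex: "\<exists>k d. coeff (f k) d > 0 \<and> dev k d \<noteq> 0"
  proof (cases "\<mu> = 1")
    case True
    then show ?thesis using nondegenerate by (auto simp: dev_def)
  next
    case False
    then show ?thesis using f_1 by (intro exI[of _ 1]) (auto simp: dev_def)
  qed
  then obtain k d where kd: "coeff (f k) d > 0" "dev k d \<noteq> 0" by blast
  have "0 < coeff (f k) d * (dev k d)\<^sup>2" using kd by simp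
  also have "\<dots> \<le> (\<Sum>i\<le>degree (f k). coeff (f k) i * (dev k i)\<^sup>2)"
    using kd le_degree[of "f k" d] f_nonneg
    by (intro member_le_sum[of d _ "\<lambda>i. coeff (f k) i * (dev k i)\<^sup>2"]) auto
  finally have "fps_nth F2 k > 0" using r by (simp add: gf_nth lin_def)
  then show ?thesis unfolding v_def
    by (intro suminf_pos2[of _ k] geom_decay_summable dev2_decay admissible_f F2_nonneg)
qed

definition R :: "real fps" where "R = inverse (1 - F0)"

lemma R_eq: "R * (1 - F0) = 1"
  unfolding R_def by (rule inverse_mult_eq_1) (simp add: F0_at_0)

lemma renewal_solution: "U = G + F0 * U \<Longrightarrow> U = R * G"
proof -
  assume "U = G + F0 * U"
  then have "(1 - F0) * U = G" by (simp add: algebra_simps)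
  then have "R * G = (R * (1 - F0)) * U" by (simp add: mult.assoc)
  then show ?thesis by (simp add: R_eq)
qed

definition c :: real where
  "c = (SOME c. c > 0 \<and> geom_decay (R - fps_const c * fps_ones))"

lemma c: "c > 0" "geom_decay (R - fps_const c * fps_ones)"
proof -
  have "\<exists>c. c > 0 \<and> geom_decay (R - fps_const c * fps_ones)"
    using renewal_geometric[OF F0_decay F0_at_0 _ F0_sum F0_at_1] tot_nonneg f_nonneg
    unfolding R_def by metis
  from someI_ex[OF this] show "c > 0" "geom_decay (R - fps_const c * fps_ones)"
    by (auto simp: c_def)
qed

definition A :: real where "A = c * (\<Sum>n. fps_nth (gf tot e) n)"

lemma A_pos: "A > 0"
proof -
  obtain k where "poly (e k) 1 > 0" using e_nonzero by blast
  then have "fps_nth (gf tot e) k > 0" using r by (simp add: gf_nth poly_1_eq_lin)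
  then have "(\<Sum>n. fps_nth (gf tot e) n) > 0"
    by (intro suminf_pos2[of _ k] geom_decay_summable E0_decay tot_nonneg e_nonneg)
  then show ?thesis using c by (simp add: A_def)
qed

lemma U0_eq: "U0 = R * gf tot e"
proof (rule renewal_solution)
  have "U0 = gf tot e + (\<Sum>j\<in>{()}. F0 * U0)"
  proof (rule gf_renewal)
    fix p q :: "real poly"
    show "lin (\<lambda>_. 1) (p * q) = (\<Sum>j\<in>{()}. lin (\<lambda>_. 1) p * lin (\<lambda>_. 1) q :: real)"
      using lin_const[of "lin (\<lambda>_. 1) q" p] by (simp add: lin_mult)
  qed
  then show "U0 = gf tot e + F0 * U0" by simp
qed

lemma U0_near: "geom_decay (U0 - fps_const A * fps_ones)"
  unfolding U0_eq A_def using geom_decay_mult_near_const[OF E0_decay c(2)] by (simp add: mult.commute)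

lemma U1_eq: "U1 = R * (gf dev e + F1 * U0)"
proof (rule renewal_solution)
  have *: "lin (dev (k + l)) (p * q) = lin (dev k) p * lin (\<lambda>_. 1) q + lin (\<lambda>_. 1) p * lin (dev l) q" for k l p q
  proof -
    have "lin (dev (k + l)) (p * q) = lin (\<lambda>i. dev k i * lin (\<lambda>_. 1) q + 1 * lin (dev l) q) p"
      unfolding lin_mult dev_add lin_fun_add by (subst lin_const) (simp add: mult.commute)
    then show ?thesis by (simp only: lin_fun_add lin_fun_mult_right)
  qed
  have "U1 = gf dev e + (\<Sum>j\<in>{True, False}. gf (if j then dev else tot) f * gf (if j then tot else dev) u)"
    by (rule gf_renewal) (simp add: *)
  then show "U1 = (gf dev e + F1 * U0) + F0 * U1" by (simp add: add.assoc)
qed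

lemma U2_eq: "U2 = R * (gf (\<lambda>n i. (dev n i)\<^sup>2) e + F2 * U0 + fps_const 2 * (F1 * U1))"
proof (rule renewal_solution)
  let ?d = "\<lambda>n i. (dev n i)\<^sup>2"
  have *: "lin (?d (k + l)) (p * q) = lin (?d k) p * lin (\<lambda>_. 1) q
      + (lin (dev k) p * lin (dev l) q + (lin (dev k) p * lin (dev l) q + lin (\<lambda>_. 1) p * lin (?d l) q))" for k l p q
  proof -
    have "(dev (k + l) (i + j))\<^sup>2 = (dev k i)\<^sup>2 + (dev k i * dev l j + (dev k i * dev l j + (dev l j)\<^sup>2))" for i j
      by (simp add: dev_add power2_eq_square algebra_simps)
    then have "lin (?d (k + l)) (p * q) = lin (\<lambda>i. ?d k i * lin (\<lambda>_. 1) q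
        + (dev k i * lin (dev l) q + (dev k i * lin (dev l) q + 1 * lin (?d l) q))) p"
      unfolding lin_mult by (simp only: lin_fun_add lin_fun_mult_left mult_1_left) 
        (subst lin_const, simp add: mult.commute)
    then show ?thesis by (simp only: lin_fun_add lin_fun_mult_right)
  qed
  \<comment> \<open>Indices 0 and 3 carry the squares of the cycle and of the remaining path; 1 and
    2 are the two copies of the cross term.\<close>
  have "U2 = gf ?d e + (\<Sum>j\<in>{0, 1, 2, 3::nat}. gf (if j = 0 then ?d else if j = 3 then tot else dev) f
       * gf (if j = 0 then tot else if j = 3 then ?d else dev) u)"
    by (rule gf_renewal) (simp add: *)
  then have "U2 = gf ?d e + (F2 * U0 + (F1 * U1 + (F1 * U1 + F0 * U2)))" by simp
  moreover have "fps_const 2 * (F1 * U1) = F1 * U1 + F1 * U1"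
    by (rule fps_ext) simp
  ultimately show "U2 = (gf ?d e + F2 * U0 + fps_const 2 * (F1 * U1)) + F0 * U2"
    by (simp only: add.assoc)
qed

text \<open>The effect of centring: as \<open>F1\<close> has sum 0, convolution with it removes the
  limit of \<open>U\<close>, so no linear growth enters \<open>U1\<close>.\<close>

lemma F1U_decay: "geom_decay (U - fps_const a * fps_ones) \<Longrightarrow> geom_decay (F1 * U)"
  using geom_decay_mult_near_const[OF dev_decay[OF admissible_f], of U a] by (simp add: F1_sum)

lemma R_near: "geom_decay G \<Longrightarrow> \<exists>a. geom_decay (R * G - fps_const a * fps_ones)"
  unfolding mult.commute[of R G] by (rule exI, rule geom_decay_mult_near_const[OF _ c(2)])

lemma U1_near: "\<exists>a. geom_decay (U1 - fps_const a * fps_ones)"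
  unfolding U1_eq by (intro R_near geom_decay_add dev_decay admissible_e F1U_decay[OF U0_near])

text \<open>The second moment of the centred reward per cycle, times the limiting density
  \<open>c\<close> of renewals.\<close>

definition \<sigma>2 :: real where "\<sigma>2 = v * c"

lemma \<sigma>2_pos: "\<sigma>2 > 0" using v_pos c by (simp add: \<sigma>2_def)

text \<open>\<open>U2 = R * G\<close>, where \<open>G\<close> tends to \<open>A * v\<close> because
  the cross term decays. The limits of \<open>R\<close> and \<open>G\<close> multiply to
  \<open>A * v * c\<close> times the square of \<open>fps_ones\<close>, whose coefficients
  \<open>n + 1\<close> give the linear growth; the other products converge.\<close>

lemma U2_near: "\<exists>l. (\<lambda>n. fps_nth U2 n - A * \<sigma>2 * real n) \<longlonglongrightarrow> l"
proof -
  define G where "G = gf (\<lambda>n i. (dev n i)\<^sup>2) e + F2 * U0 + fps_const 2 * (F1 * U1)"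
  obtain a where a: "geom_decay (U1 - fps_const a * fps_ones)" using U1_near by blast
  have "geom_decay (F2 * U0 - fps_const (A * v) * fps_ones)"
    unfolding v_def by (intro geom_decay_mult_near_const dev2_decay admissible_f U0_near)
  then have "geom_decay (gf (\<lambda>n i. (dev n i)\<^sup>2) e + (F2 * U0 - fps_const (A * v) * fps_ones)
      + fps_const 2 * (F1 * U1))"
    by (intro geom_decay_add dev2_decay admissible_e geom_decay_const_mult F1U_decay[OF a])
  then have G: "geom_decay (G - fps_const (A * v) * fps_ones)" by (simp add: G_def algebra_simps)
  obtain a1 where a1: "geom_decay (R * (G - fps_const (A * v) * fps_ones) - fps_const a1 * fps_ones)"
    using R_near[OF G] by blast
  obtain a2 where a2: "geom_decay ((R - fps_const c * fps_ones) * fps_ones - fps_const a2 * fps_ones)"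
    using geom_decay_partial_sums[OF c(2)] by blast
  define X where "X = R * (G - fps_const (A * v) * fps_ones)"
  define Y where "Y = (R - fps_const c * fps_ones) * fps_ones"
  have "U2 = X + fps_const (A * v) * Y + fps_const (A * v * c) * (fps_ones * fps_ones)"
    unfolding U2_eq G_def[symmetric] X_def Y_def by (simp add: algebra_simps flip: fps_const_mult)
  then have "fps_nth U2 n = fps_nth X n + A * v * fps_nth Y n + A * v * c * (real n + 1)" for n
    by (simp only: fps_add_nth fps_mult_left_const_nth fps_mult_ones_nth fps_nth_Abs_fps) simp
  then have eq: "(\<lambda>n. fps_nth U2 n - A * \<sigma>2 * real n) = (\<lambda>n. fps_nth X n + A * v * fps_nth Y n + A * v * c)"
    by (intro ext) (simp add: \<sigma>2_def distrib_left)
  have X: "fps_nth X \<longlonglongrightarrow> a1" and Y: "fps_nth Y \<longlonglongrightarrow> a2"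
    unfolding X_def Y_def by (rule near_const_tendsto[OF a1], rule near_const_tendsto[OF a2])
  have "(\<lambda>n. fps_nth U2 n - A * \<sigma>2 * real n) \<longlonglongrightarrow> a1 + A * v * a2 + A * v * c"
    unfolding eq by (rule tendsto_add[OF tendsto_add[OF X tendsto_mult[OF tendsto_const Y]] tendsto_const])
  then show ?thesis by blast
qed

lemma mean_tendsto: "\<exists>l. (\<lambda>n. fps_nth U1 n / fps_nth U0 n) \<longlonglongrightarrow> l"
proof -
  obtain a where a: "geom_decay (U1 - fps_const a * fps_ones)" using U1_near by blast
  have "(\<lambda>n. fps_nth U1 n / fps_nth U0 n) \<longlonglongrightarrow> a / A"
    by (intro tendsto_divide near_const_tendsto a U0_near) (use A_pos in auto)
  then show ?thesis by blast
qed

lemma variance_tendsto: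
  "\<exists>l. (\<lambda>n. fps_nth U2 n / fps_nth U0 n - (fps_nth U1 n / fps_nth U0 n)\<^sup>2 - \<sigma>2 * real n) \<longlonglongrightarrow> l"
proof -
  obtain l1 where l1: "(\<lambda>n. fps_nth U1 n / fps_nth U0 n) \<longlonglongrightarrow> l1" using mean_tendsto ..
  obtain l2 where l2: "(\<lambda>n. fps_nth U2 n - A * \<sigma>2 * real n) \<longlonglongrightarrow> l2" using U2_near ..
  have U0: "fps_nth U0 \<longlonglongrightarrow> A" by (rule near_const_tendsto[OF U0_near])
  \<comment> \<open>Dividing by \<open>U0\<close> instead of its limit \<open>A\<close> disturbs the
    linear term by \<open>n\<close> times the difference, which is harmless only because
    \<open>U0\<close> converges geometrically.\<close>
  have "(\<lambda>n. real n * fps_nth (U0 - fps_const A * fps_ones) n) \<longlonglongrightarrow> 0"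
    by (rule geom_decay_times_n_tendsto_0[OF U0_near])
  then have "(\<lambda>n. (fps_nth U2 n - A * \<sigma>2 * real n) / fps_nth U0 n
     - \<sigma>2 * (real n * fps_nth (U0 - fps_const A * fps_ones) n) / fps_nth U0 n
     - (fps_nth U1 n / fps_nth U0 n)\<^sup>2) \<longlonglongrightarrow> l2 / A - \<sigma>2 * 0 / A - l1\<^sup>2"
    using A_pos
    by (intro tendsto_diff[OF tendsto_diff[OF tendsto_divide[OF l2 U0]
          tendsto_divide[OF tendsto_mult[OF tendsto_const] U0]] tendsto_power[OF l1]]) auto
  moreover have "\<forall>\<^sub>F n in sequentially. fps_nth U0 n > 0"
    using order_tendstoD(1)[OF U0 A_pos] .
  then have "\<forall>\<^sub>F n in sequentially. (fps_nth U2 n - A * \<sigma>2 * real n) / fps_nth U0 n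
     - \<sigma>2 * (real n * fps_nth (U0 - fps_const A * fps_ones) n) / fps_nth U0 n
     - (fps_nth U1 n / fps_nth U0 n)\<^sup>2
     = fps_nth U2 n / fps_nth U0 n - (fps_nth U1 n / fps_nth U0 n)\<^sup>2 - \<sigma>2 * real n"
    by eventually_elim (simp add: field_simps)
  ultimately show ?thesis by (blast intro: Lim_transform_eventually)
qed

subsection \<open>Characteristic functions\<close>

definition ch :: "real \<Rightarrow> nat \<Rightarrow> nat \<Rightarrow> complex" where
  "ch t n i = cis (t * dev n i)"

lemma gf_ch_eq: "gf (ch t) u = gf (ch t) e + gf (ch t) f * gf (ch t) u"
proof -
  have "gf (ch t) u = gf (ch t) e + (\<Sum>j\<in>{()}. gf (ch t) f * gf (ch t) u)"
  proof (rule gf_renewal)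
    fix k l and p q :: "real poly"
    have "ch t (k + l) (i + j) = ch t k i * ch t l j" for i j
      by (simp add: ch_def dev_add cis_mult distrib_left)
    then show "lin (ch t (k + l)) (p * q) = (\<Sum>j\<in>{()}. lin (ch t k) p * lin (ch t l) q)"
      by (simp add: lin_mult lin_fun_mult_left lin_fun_mult_right)
  qed
  then show ?thesis by simp
qed

definition pert :: "real \<Rightarrow> (nat \<Rightarrow> real poly) \<Rightarrow> complex fps" where
  "pert t p = gf (ch t) p - fps_of_real (gf tot p)"

lemma pert_eq_gf: "pert t p = gf (\<lambda>n i. ch t n i - 1) p"
proof (rule fps_ext)
  fix n
  have "lin (\<lambda>_. 1 :: complex) (p n) = of_real (lin (\<lambda>_. 1) (p n))"
    using lin_of_real[of "\<lambda>_. 1" "p n"] by simp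
  then show "fps_nth (pert t p) n = fps_nth (gf (\<lambda>n i. ch t n i - 1) p) n"
    by (simp add: pert_def gf_nth lin_fun_diff left_diff_distrib)
qed

lemma norm_pert_le:
  assumes "admissible p"
  shows "norm (fps_nth (pert t p) n) \<le> \<bar>t\<bar> * L * fps_nth (wdecay 1 p) n"
proof -
  have "norm (ch t n i - 1) \<le> \<bar>t\<bar> * L * real (Suc n) ^ 1" if "i \<le> Suc n" for n i
  proof -
    have "norm (ch t n i - 1) \<le> \<bar>t * dev n i\<bar>"
      using iexp_approx1[of "t * dev n i" 0] by (simp add: ch_def cis_conv_exp)
    also have "\<dots> \<le> \<bar>t\<bar> * (L * real (Suc n))"
      unfolding abs_mult using that by (intro mult_left_mono abs_dev_le) auto
    finally show ?thesis by (simp add: mult.assoc)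
  qed
  from gf_norm_le[OF assms this] show ?thesis by (simp add: pert_eq_gf wdecay_def)
qed

lemma pert_decay: "admissible p \<Longrightarrow> geom_decay (pert t p)"
  by (rule geom_decay_pow_mono[of "wdecay 1 p" _ "\<bar>t\<bar> * L" 0])
    (use norm_pert_le wdecay_decay wdecay_nonneg in auto)

definition pert_sum :: "real \<Rightarrow> complex" where
  "pert_sum t = (\<Sum>n. fps_nth (pert t f) n)"

lemma norm_gf_ch_u_le: "norm (fps_nth (gf (ch t) u) n) \<le> fps_nth U0 n"
proof -
  have "norm (lin (ch t n) (u n)) \<le> 1 * lin (\<lambda>_. 1) (u n)"
    by (intro norm_lin_le u_nonneg) (simp add: ch_def)
  then show ?thesis using r by (simp add: gf_nth norm_mult norm_power)
qed

text \<open>Multiply the perturbed renewal equation by \<open>R\<close>. The constant part of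
  \<open>R * pert t f\<close> convolves to the partial sums; everything else is a bounded sequence
  times a summable one of size O(t), so the error is uniform in \<open>n\<close>.\<close>

lemma gf_ch_volterra:
  obtains K where "K \<ge> 0" "\<And>t n. norm (fps_nth (gf (ch t) u) n
     - (of_real (fps_nth U0 n) + of_real c * pert_sum t * (\<Sum>j\<le>n. fps_nth (gf (ch t) u) j))) \<le> K * \<bar>t\<bar>"
proof -
  \<comment> \<open>The remainder \<open>X t\<close> of \<open>R * pert t f\<close> consists of the
    remainder \<open>Q\<close> of \<open>R\<close> and the tails of \<open>pert t f\<close>. Up to
    the factor \<open>|t| * L\<close> it is majorised by the decaying series \<open>Xb\<close>,
    which is free of \<open>t\<close>.\<close>
  define Q where "Q = R - fps_const c * fps_ones"
  define D where "D = wdecay 1 f"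
  define T where "T = fps_const (\<Sum>n. fps_nth D n) * fps_ones - D * fps_ones"
  define Xb where "Xb = Abs_fps (\<lambda>n. norm (fps_nth Q n)) * D + fps_const c * T"
  have D: "geom_decay D" by (simp add: D_def wdecay_decay admissible_f)
  have T: "geom_decay T" using geom_decay_uminus[OF geom_decay_partial_sums[OF D]] by (simp add: T_def)
  have Xb: "geom_decay Xb"
    using c(2) unfolding Xb_def Q_def[symmetric]
    by (intro geom_decay_add geom_decay_mult geom_decay_norm geom_decay_const_mult D T)
  have norm_Q: "norm (fps_nth (fps_of_real Q) n) \<le> fps_nth (Abs_fps (\<lambda>n. norm (fps_nth Q n))) n" for n
    by simp
  obtain Um where Um: "\<And>n. \<bar>fps_nth U0 n\<bar> \<le> Um" using near_const_bounded[OF U0_near] by blast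
  obtain Rm where Rm: "\<And>n. \<bar>fps_nth R n\<bar> \<le> Rm" using near_const_bounded[OF c(2)] by blast
  define X where "X t = fps_of_real Q * pert t f
     - fps_const (of_real c) * (fps_const (pert_sum t) * fps_ones - pert t f * fps_ones)" for t
  have Xle: "norm (fps_nth (X t) n) \<le> \<bar>t\<bar> * L * fps_nth Xb n" for t n
  proof -
    have 1: "norm (fps_nth (fps_of_real Q * pert t f) n)
        \<le> \<bar>t\<bar> * L * fps_nth (Abs_fps (\<lambda>n. norm (fps_nth Q n)) * D) n"
      unfolding D_def by (rule fps_mult_norm_le[OF norm_Q norm_pert_le[OF admissible_f]])
    have "norm (fps_nth (fps_const (pert_sum t) * fps_ones - pert t f * fps_ones) n) \<le> \<bar>t\<bar> * L * fps_nth T n"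
      unfolding T_def pert_sum_def
      by (rule tail_bound) (use norm_pert_le[OF admissible_f] pert_decay[OF admissible_f] D in \<open>auto simp: D_def\<close>)
    then have 2: "norm (fps_nth (fps_const (of_real c) * (fps_const (pert_sum t) * fps_ones - pert t f * fps_ones)) n)
        \<le> c * (\<bar>t\<bar> * L * fps_nth T n)"
      unfolding fps_mult_left_const_nth norm_mult using c(1) by (simp add: mult_left_mono)
    have "norm (fps_nth (X t) n) \<le> \<bar>t\<bar> * L * fps_nth (Abs_fps (\<lambda>n. norm (fps_nth Q n)) * D) n + c * (\<bar>t\<bar> * L * fps_nth T n)"
      unfolding X_def fps_sub_nth by (intro order_trans[OF norm_triangle_ineq4] add_mono 1 2)
    also have "\<dots> = \<bar>t\<bar> * L * fps_nth Xb n"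
      by (simp add: Xb_def distrib_left)
    finally show ?thesis .
  qed
  have Tnn: "fps_nth T n \<ge> 0" for n
    using sum_le_suminf[OF geom_decay_summable[OF D], of "{..n}"] wdecay_nonneg[OF admissible_f, of 1]
    by (simp add: T_def D_def fps_mult_ones_nth)
  have Xbnn: "fps_nth Xb n \<ge> 0" for n
    unfolding Xb_def using Tnn c(1) wdecay_nonneg[OF admissible_f, of 1]
    by (auto simp: fps_mult_nth D_def intro!: add_nonneg_nonneg sum_nonneg)
  define K where "K = Rm * L * (\<Sum>n. fps_nth (wdecay 1 e) n) + Um * L * (\<Sum>n. fps_nth Xb n)"
  have main: "norm (fps_nth (gf (ch t) u) n
     - (of_real (fps_nth U0 n) + of_real c * pert_sum t * (\<Sum>j\<le>n. fps_nth (gf (ch t) u) j))) \<le> K * \<bar>t\<bar>" for t n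
  proof -
    let ?U = "gf (ch t) u" and ?R = "fps_of_real R"
    have RR: "?R * (1 - fps_of_real F0) = 1"
      using arg_cong[OF R_eq, of fps_of_real] by (simp add: fps_of_real_mult fps_of_real_diff)
    have "?U * (1 - fps_of_real F0) = gf (ch t) e + pert t f * ?U"
      using gf_ch_eq[of t] by (simp add: pert_def algebra_simps)
    then have "?R * (?U * (1 - fps_of_real F0)) = ?R * (gf (ch t) e + pert t f * ?U)" by simp
    then have "?U * (?R * (1 - fps_of_real F0)) = ?R * gf (ch t) e + (?R * pert t f) * ?U"
      by (simp add: distrib_left mult.assoc mult.left_commute)
    then have U: "?U = ?R * gf (ch t) e + (?R * pert t f) * ?U" by (simp add: RR)
    have Re: "?R * gf (ch t) e = fps_of_real U0 + ?R * pert t e"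
      by (simp add: U0_eq pert_def fps_of_real_mult algebra_simps)
    have Rp: "?R * pert t f = fps_const (of_real c * pert_sum t) * fps_ones + X t"
    proof -
      have "?R = fps_of_real Q + fps_const (of_real c) * fps_ones"
        by (simp add: Q_def fps_of_real_diff fps_of_real_mult)
      then show ?thesis by (simp add: X_def algebra_simps flip: fps_const_mult)
    qed
    have "?U = fps_of_real U0 + fps_const (of_real c * pert_sum t) * (?U * fps_ones) + (?R * pert t e + ?U * X t)"
      by (subst U) (simp add: Re Rp algebra_simps)
    then have "fps_nth ?U n = of_real (fps_nth U0 n) + of_real c * pert_sum t * (\<Sum>j\<le>n. fps_nth ?U j)
        + (fps_nth (?R * pert t e) n + fps_nth (?U * X t) n)"
      by (metis fps_add_nth fps_mult_left_const_nth fps_mult_ones_nth fps_of_real_nth)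
    then have "norm (fps_nth ?U n - (of_real (fps_nth U0 n) + of_real c * pert_sum t * (\<Sum>j\<le>n. fps_nth ?U j)))
        = norm (fps_nth (?R * pert t e) n + fps_nth (?U * X t) n)" by simp
    also have "\<dots> \<le> Rm * (\<bar>t\<bar> * L) * (\<Sum>n. fps_nth (wdecay 1 e) n) + Um * (\<bar>t\<bar> * L) * (\<Sum>n. fps_nth Xb n)"
    proof (intro order_trans[OF norm_triangle_ineq] add_mono)
      show "norm (fps_nth (?R * pert t e) n) \<le> Rm * (\<bar>t\<bar> * L) * (\<Sum>n. fps_nth (wdecay 1 e) n)"
        by (rule fps_mult_bounded) (use Rm norm_pert_le[OF admissible_e] wdecay_nonneg[OF admissible_e]
            geom_decay_summable[OF wdecay_decay[OF admissible_e]] L in auto)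
      have "norm (fps_nth ?U n) \<le> Um" for n using norm_gf_ch_u_le[of t n] Um[of n] by linarith
      then show "norm (fps_nth (?U * X t) n) \<le> Um * (\<bar>t\<bar> * L) * (\<Sum>n. fps_nth Xb n)"
        by (rule fps_mult_bounded) (use Xle Xbnn geom_decay_summable[OF Xb] L in auto)
    qed
    also have "\<dots> = K * \<bar>t\<bar>" by (simp add: K_def algebra_simps)
    finally show ?thesis .
  qed
  have "0 \<le> K * \<bar>1\<bar>" using order_trans[OF norm_ge_zero main[of 1 0]] .
  then show ?thesis using main that[of K] by simp
qed

text \<open>A characteristic function has norm at most 1. This keeps \<open>1 / (1 + z)\<close> in
  the unit disc for \<open>z = - c * pert_sum t\<close>.\<close>

lemma Re_pert_sum_le_0: "Re (pert_sum t) \<le> 0"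
proof -
  have "Re (fps_nth (pert t f) n) \<le> 0" for n
  proof -
    have "norm (lin (ch t n) (f n)) \<le> 1 * lin (\<lambda>_. 1) (f n)"
      by (intro norm_lin_le f_nonneg) (simp add: ch_def)
    then have "Re (lin (ch t n) (f n)) \<le> lin (\<lambda>_. 1) (f n)"
      using complex_Re_le_cmod[of "lin (ch t n) (f n)"] by linarith
    then have "(Re (lin (ch t n) (f n)) - lin (\<lambda>_. 1) (f n)) * r ^ n \<le> 0"
      using r by (intro mult_nonpos_nonneg) auto
    then show ?thesis
      by (simp add: pert_def gf_nth left_diff_distrib flip: of_real_power)
  qed
  then have "(\<Sum>n. Re (fps_nth (pert t f) n)) \<le> (\<Sum>n. 0)"
    by (intro suminf_le summable_Re geom_decay_summable pert_decay admissible_f) auto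
  moreover have "Re (pert_sum t) = (\<Sum>n. Re (fps_nth (pert t f) n))"
    unfolding pert_sum_def by (rule Re_suminf) (intro geom_decay_summable pert_decay admissible_f)
  ultimately show ?thesis by simp
qed

text \<open>Taylor expansion of \<open>cis\<close> under the sum over cycles: the linear term drops
  out by centring, the quadratic one gives \<open>v\<close>, and cubic weights still have a finite
  sum.\<close>

lemma pert_sum_expansion:
  obtains K where "K \<ge> 0" "\<And>t. norm (pert_sum t + of_real (v * t\<^sup>2 / 2)) \<le> K * \<bar>t\<bar> ^ 3"
proof -
  define K where "K = L ^ 3 / 6 * (\<Sum>n. fps_nth (wdecay 3 f) n)"
  have "norm (pert_sum t + of_real (v * t\<^sup>2 / 2)) \<le> K * \<bar>t\<bar> ^ 3" for t
  proof -
    define h where "h n i = ch t n i - 1 - \<i> * of_real t * of_real (dev n i)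
        + of_real (t\<^sup>2 / 2) * of_real ((dev n i)\<^sup>2)" for n i
    have h_le: "norm (h n i) \<le> \<bar>t\<bar> ^ 3 * L ^ 3 / 6 * real (Suc n) ^ 3" if "i \<le> Suc n" for n i
    proof -
      have "norm (h n i) \<le> \<bar>t * dev n i\<bar> ^ 3 / 6"
        using iexp_approx1[of "t * dev n i" 2]
        by (simp add: h_def ch_def cis_conv_exp eval_nat_numeral algebra_simps fact_numeral)
      also have "\<dots> \<le> (\<bar>t\<bar> * (L * real (Suc n))) ^ 3 / 6"
        unfolding abs_mult using that by (intro divide_right_mono power_mono mult_left_mono abs_dev_le) auto
      finally show ?thesis by (simp add: power_mult_distrib)
    qed
    have nth: "fps_nth (gf h f) n = fps_nth (pert t f) n - \<i> * of_real t * of_real (fps_nth F1 n)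
        + of_real (t\<^sup>2 / 2) * of_real (fps_nth F2 n)" for n
    proof -
      have "lin (h n) (f n) = lin (\<lambda>i. ch t n i - 1) (f n) - \<i> * of_real t * of_real (lin (dev n) (f n))
         + of_real (t\<^sup>2 / 2) * of_real (lin (\<lambda>i. (dev n i)\<^sup>2) (f n))"
        unfolding h_def[abs_def] by (simp only: lin_fun_add lin_fun_diff[of "\<lambda>i. ch t n i - 1"] lin_fun_mult_left lin_of_real)
      then show ?thesis by (simp add: pert_eq_gf gf_nth distrib_right left_diff_distrib mult.assoc)
    qed
    have s1: "fps_nth (pert t f) sums pert_sum t"
      unfolding pert_sum_def by (intro summable_sums geom_decay_summable pert_decay admissible_f)
    have s2: "fps_nth F1 sums 0"
      using summable_sums[OF geom_decay_summable[OF dev_decay[OF admissible_f]]] by (simp add: F1_sum)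
    have s3: "fps_nth F2 sums v"
      unfolding v_def by (intro summable_sums geom_decay_summable dev2_decay admissible_f)
    have "fps_nth (gf h f) sums (pert_sum t - \<i> * of_real t * of_real 0 + of_real (t\<^sup>2 / 2) * of_real v)"
      unfolding nth[abs_def]
      by (rule sums_add[OF sums_diff[OF s1 sums_mult[OF sums_of_real[OF s2]]] sums_mult[OF sums_of_real[OF s3]]])
    then have eq: "(\<Sum>n. fps_nth (gf h f) n) = pert_sum t + of_real (v * t\<^sup>2 / 2)"
      by (simp add: sums_iff mult.commute)
    have le: "norm (fps_nth (gf h f) n) \<le> \<bar>t\<bar> ^ 3 * L ^ 3 / 6 * fps_nth (wdecay 3 f) n" for n
      using gf_norm_le[OF admissible_f h_le] by (simp add: wdecay_def)
    have sw: "summable (fps_nth (wdecay 3 f))"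
      by (intro geom_decay_summable wdecay_decay admissible_f)
    have sh: "summable (\<lambda>n. norm (fps_nth (gf h f) n))"
      by (intro geom_decay_summable_norm gf_decay[OF admissible_f h_le])
    have "norm (\<Sum>n. fps_nth (gf h f) n) \<le> (\<Sum>n. norm (fps_nth (gf h f) n))"
      by (rule summable_norm[OF sh])
    also have "\<dots> \<le> (\<Sum>n. \<bar>t\<bar> ^ 3 * L ^ 3 / 6 * fps_nth (wdecay 3 f) n)"
      by (intro suminf_le le sh summable_mult sw)
    also have "\<dots> = K * \<bar>t\<bar> ^ 3" by (subst suminf_mult[OF sw]) (simp add: K_def)
    finally show ?thesis by (simp add: eq)
  qed
  moreover have "K \<ge> 0"
    unfolding K_def using L
    by (intro mult_nonneg_nonneg suminf_nonneg geom_decay_summable wdecay_decay wdecay_nonneg admissible_f) auto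
  ultimately show ?thesis using that by blast
qed

text \<open>As \<open>n * t^2\<close> stays bounded and \<open>z = O(t^2)\<close>, the Volterra
  error O(t) per step accumulates to \<open>O(n * t^3)\<close>, and replacing
  \<open>1 / (1 + z)\<close> by an exponential costs the same order. Both vanish.\<close>

lemma gf_ch_tendsto:
  fixes t :: "nat \<Rightarrow> real"
  assumes t: "(\<lambda>n. real n * (t n)\<^sup>2) \<longlonglongrightarrow> s"
  shows "(\<lambda>n. fps_nth (gf (ch (t n)) u) n) \<longlonglongrightarrow> of_real (A * exp (- \<sigma>2 * s / 2))"
proof -
  obtain K1 where K1: "K1 \<ge> 0" "\<And>t n. norm (fps_nth (gf (ch t) u) n
     - (of_real (fps_nth U0 n) + of_real c * pert_sum t * (\<Sum>j\<le>n. fps_nth (gf (ch t) u) j))) \<le> K1 * \<bar>t\<bar>"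
    using gf_ch_volterra by blast
  obtain K2 where K2: "K2 \<ge> 0" "\<And>t. norm (pert_sum t + of_real (v * t\<^sup>2 / 2)) \<le> K2 * \<bar>t\<bar> ^ 3"
    using pert_sum_expansion by blast
  \<comment> \<open>Replacing the inhomogeneity \<open>U0\<close> by the constant \<open>A\<close>
    adds \<open>a\<close> to the error; its norms have the finite sum \<open>S\<close>.\<close>
  define a where "a = U0 - fps_const A * fps_ones"
  define S where "S = (\<Sum>n. norm (fps_nth a n))"
  have a: "summable (\<lambda>n. norm (fps_nth a n))"
    unfolding a_def by (rule geom_decay_summable_norm[OF U0_near])
  define z where "z n = - of_real c * pert_sum (t n)" for n
  define y where "y n = \<sigma>2 * (t n)\<^sup>2 / 2" for n
  have z0: "Re (z n) \<ge> 0" for n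
    using Re_pert_sum_le_0[of "t n"] c(1) by (simp add: z_def mult_nonneg_nonpos)
  have y0: "y n \<ge> 0" for n using \<sigma>2_pos by (simp add: y_def)
  have zy: "norm (z n - of_real (y n)) \<le> c * K2 * \<bar>t n\<bar> ^ 3" for n
  proof -
    have "z n - of_real (y n) = - of_real c * (pert_sum (t n) + of_real (v * (t n)\<^sup>2 / 2))"
      by (simp add: z_def y_def \<sigma>2_def algebra_simps)
    then have "norm (z n - of_real (y n)) = c * norm (pert_sum (t n) + of_real (v * (t n)\<^sup>2 / 2))"
      using c(1) by (simp add: norm_mult)
    also have "\<dots> \<le> c * (K2 * \<bar>t n\<bar> ^ 3)" using c(1) K2 by (intro mult_left_mono) auto
    finally show ?thesis by simp
  qed
  have z_le: "norm (z n) \<le> \<sigma>2 * (t n)\<^sup>2 / 2 + c * K2 * \<bar>t n\<bar> ^ 3" for n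
  proof -
    have "norm (of_real (y n) :: complex) = y n" using y0[of n] by (simp only: norm_of_real abs_of_nonneg)
    then have "norm (z n) \<le> y n + c * K2 * \<bar>t n\<bar> ^ 3"
      using norm_triangle_ineq2[of "z n" "of_real (y n)"] zy[of n] by linarith
    then show ?thesis by (simp add: y_def)
  qed
  have t2: "(\<lambda>n. (t n)\<^sup>2) \<longlonglongrightarrow> 0"
  proof -
    have "(\<lambda>n. real n * (t n)\<^sup>2 * inverse (real n)) \<longlonglongrightarrow> s * 0"
      by (rule tendsto_mult[OF t lim_inverse_n])
    moreover have "\<forall>\<^sub>F n in sequentially. real n * (t n)\<^sup>2 * inverse (real n) = (t n)\<^sup>2"
      using eventually_gt_at_top[of 0] by eventually_elim simp
    ultimately show ?thesis by (simp add: Lim_transform_eventually)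
  qed
  then have t1: "(\<lambda>n. \<bar>t n\<bar>) \<longlonglongrightarrow> 0"
    using tendsto_real_sqrt[OF t2] by simp
  define q where "q n = real (Suc n) * (t n)\<^sup>2" for n
  have q: "q \<longlonglongrightarrow> s"
    using tendsto_add[OF t t2] by (simp add: q_def[abs_def] algebra_simps)
  have 1: "norm (fps_nth (gf (ch (t n)) u) n - of_real A * (1 / (1 + z n)) ^ Suc n)
      \<le> (K1 * \<bar>t n\<bar> + norm (fps_nth a n)) + (\<sigma>2 / 2 + c * K2 * \<bar>t n\<bar>) * (K1 * q n * \<bar>t n\<bar> + S * (t n)\<^sup>2)" for n
  proof -
    \<comment> \<open>The argument \<open>t n\<close> is frozen, and the equation is used at all
      indices \<open>j\<close> up to \<open>n\<close>.\<close>
    let ?x = "\<lambda>j. fps_nth (gf (ch (t n)) u) j" and ?\<eta> = "\<lambda>j. K1 * \<bar>t n\<bar> + norm (fps_nth a j)"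
    have "norm (?x j - (of_real A - z n * (\<Sum>i\<le>j. ?x i))) \<le> ?\<eta> j" for j
    proof -
      have eq: "?x j - (of_real A - z n * (\<Sum>i\<le>j. ?x i))
         = (?x j - (of_real (fps_nth U0 j) + of_real c * pert_sum (t n) * (\<Sum>i\<le>j. ?x i))) + of_real (fps_nth a j)"
        by (simp add: z_def a_def)
      show ?thesis unfolding eq by (rule norm_triangle_mono[OF K1(2)]) simp
    qed
    then have "norm (?x n - of_real A * (1 / (1 + z n)) ^ Suc n) \<le> ?\<eta> n + norm (z n) * (\<Sum>j\<le>n. ?\<eta> j)"
      by (rule volterra_perturbation[OF z0])
    also have "norm (z n) * (\<Sum>j\<le>n. ?\<eta> j) \<le> (\<sigma>2 * (t n)\<^sup>2 / 2 + c * K2 * \<bar>t n\<bar> ^ 3) * (real (Suc n) * K1 * \<bar>t n\<bar> + S)"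
    proof (rule mult_mono[OF z_le])
      have "(\<Sum>j\<le>n. norm (fps_nth a j)) \<le> S" unfolding S_def by (rule sum_le_suminf[OF a]) auto
      then show "(\<Sum>j\<le>n. ?\<eta> j) \<le> real (Suc n) * K1 * \<bar>t n\<bar> + S" by (simp add: sum.distrib)
      show "0 \<le> \<sigma>2 * (t n)\<^sup>2 / 2 + c * K2 * \<bar>t n\<bar> ^ 3" using \<sigma>2_pos c(1) K2(1) by simp
      show "0 \<le> (\<Sum>j\<le>n. ?\<eta> j)" using K1(1) by (intro sum_nonneg) auto
    qed
    also have "\<dots> = (\<sigma>2 / 2 + c * K2 * \<bar>t n\<bar>) * (K1 * q n * \<bar>t n\<bar> + S * (t n)\<^sup>2)"
    proof -
      have "\<bar>t n\<bar> ^ 3 = \<bar>t n\<bar> * (t n)\<^sup>2" by (simp add: power3_eq_cube power2_eq_square flip: abs_mult)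
      then show ?thesis by (simp add: q_def algebra_simps)
    qed
    finally show ?thesis by simp
  qed
  have "(\<lambda>n. (K1 * \<bar>t n\<bar> + norm (fps_nth a n)) + (\<sigma>2 / 2 + c * K2 * \<bar>t n\<bar>) * (K1 * q n * \<bar>t n\<bar> + S * (t n)\<^sup>2))
      \<longlonglongrightarrow> (K1 * 0 + 0) + (\<sigma>2 / 2 + c * K2 * 0) * (K1 * s * 0 + S * 0)"
    by (intro tendsto_add tendsto_mult tendsto_const t1 t2 q summable_LIMSEQ_zero[OF a])
  then have l1: "(\<lambda>n. fps_nth (gf (ch (t n)) u) n - of_real A * (1 / (1 + z n)) ^ Suc n) \<longlonglongrightarrow> 0"
    by (intro Lim_null_comparison[OF always_eventually[OF allI[OF 1]]]) simp
  have 2: "norm ((1 / (1 + z n)) ^ Suc n - of_real (exp (- y n * real (Suc n))))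
      \<le> c * K2 * q n * \<bar>t n\<bar> + (\<sigma>2 / 2)\<^sup>2 * q n * (t n)\<^sup>2" for n
  proof -
    have "norm ((1 / (1 + z n)) ^ Suc n - of_real (exp (- y n * real (Suc n))))
        \<le> real (Suc n) * (norm (z n - of_real (y n)) + (y n)\<^sup>2)"
      by (rule power_inverse_exp_diff[OF z0 y0])
    also have "\<dots> \<le> real (Suc n) * (c * K2 * \<bar>t n\<bar> ^ 3 + (y n)\<^sup>2)"
      using zy by (intro mult_left_mono add_right_mono) auto
    also have "\<dots> = c * K2 * q n * \<bar>t n\<bar> + (\<sigma>2 / 2)\<^sup>2 * q n * (t n)\<^sup>2"
    proof -
      have "\<bar>t n\<bar> ^ 3 = \<bar>t n\<bar> * (t n)\<^sup>2" by (simp add: power3_eq_cube power2_eq_square flip: abs_mult)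
      moreover have "(y n)\<^sup>2 = (\<sigma>2 / 2)\<^sup>2 * (t n)\<^sup>2 * (t n)\<^sup>2" by (simp add: y_def power2_eq_square)
      ultimately show ?thesis by (simp only: q_def distrib_left) (simp add: ac_simps)
    qed
    finally show ?thesis .
  qed
  have "(\<lambda>n. c * K2 * q n * \<bar>t n\<bar> + (\<sigma>2 / 2)\<^sup>2 * q n * (t n)\<^sup>2) \<longlonglongrightarrow> c * K2 * s * 0 + (\<sigma>2 / 2)\<^sup>2 * s * 0"
    by (intro tendsto_add tendsto_mult tendsto_const t1 t2 q)
  then have l2: "(\<lambda>n. (1 / (1 + z n)) ^ Suc n - of_real (exp (- y n * real (Suc n)))) \<longlonglongrightarrow> 0"
    by (intro Lim_null_comparison[OF always_eventually[OF allI[OF 2]]]) simp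
  have "(\<lambda>n. of_real (exp (- (\<sigma>2 / 2) * q n)) :: complex) \<longlonglongrightarrow> of_real (exp (- (\<sigma>2 / 2) * s))"
    by (intro tendsto_of_real tendsto_exp tendsto_mult tendsto_const q)
  then have l3: "(\<lambda>n. of_real (exp (- y n * real (Suc n))) :: complex) \<longlonglongrightarrow> of_real (exp (- \<sigma>2 * s / 2))"
    by (simp add: y_def q_def ac_simps)
  have "(\<lambda>n. (fps_nth (gf (ch (t n)) u) n - of_real A * (1 / (1 + z n)) ^ Suc n)
      + of_real A * (((1 / (1 + z n)) ^ Suc n - of_real (exp (- y n * real (Suc n)))) + of_real (exp (- y n * real (Suc n)))))
      \<longlonglongrightarrow> 0 + of_real A * (0 + of_real (exp (- \<sigma>2 * s / 2)))"
    by (intro tendsto_add tendsto_mult tendsto_const l1 l2 l3)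
  then show ?thesis by simp
qed

section \<open>Passage to the standardised reward\<close>

definition mean :: "nat \<Rightarrow> real" where
  "mean n = lin real (u n) / lin (\<lambda>_. 1) (u n)"

definition var :: "nat \<Rightarrow> real" where
  "var n = lin (\<lambda>i. (real i - mean n)\<^sup>2) (u n) / lin (\<lambda>_. 1) (u n)"

lemma gf_quotient: "fps_nth (gf g u) n / of_real (fps_nth U0 n) = lin (g n) (u n) / of_real (lin (\<lambda>_. 1) (u n))"
  using r by (simp add: gf_nth)

lemma mean_diff:
  assumes "lin (\<lambda>_. 1) (u n) \<noteq> (0::real)"
  shows "mean n - \<mu> * real n = fps_nth U1 n / fps_nth U0 n"
proof -
  have "lin (\<lambda>_. \<mu> * real n) (u n) = lin (\<lambda>_. 1) (u n) * (\<mu> * real n)" by (rule lin_const)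
  then have "lin (dev n) (u n) = lin real (u n) - lin (\<lambda>_. 1) (u n) * (\<mu> * real n)"
    by (simp add: dev_def[abs_def] lin_fun_diff)
  then show ?thesis
    using gf_quotient[of dev n] assms by (simp add: mean_def diff_divide_distrib)
qed

text \<open>Moving the centre from \<open>\<mu> * n\<close> to the exact mean subtracts the square
  of the shift.\<close>

lemma var_eq:
  assumes nz: "lin (\<lambda>_. 1) (u n) \<noteq> (0::real)"
  shows "var n = fps_nth U2 n / fps_nth U0 n - (fps_nth U1 n / fps_nth U0 n)\<^sup>2"
proof -
  define d where "d = mean n - \<mu> * real n"
  define Z where "Z = lin (\<lambda>_. 1 :: real) (u n)"
  have "(real i - mean n)\<^sup>2 = (dev n i)\<^sup>2 - 2 * d * dev n i + d\<^sup>2" for i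
    by (simp add: dev_def d_def power2_eq_square algebra_simps)
  then have "lin (\<lambda>i. (real i - mean n)\<^sup>2) (u n)
      = lin (\<lambda>i. (dev n i)\<^sup>2) (u n) - 2 * d * lin (dev n) (u n) + Z * d\<^sup>2"
    using lin_const[of "d\<^sup>2" "u n"] by (simp add: lin_fun_add lin_fun_diff lin_fun_mult_left Z_def)
  then have "var n = lin (\<lambda>i. (dev n i)\<^sup>2) (u n) / Z - 2 * d * (lin (dev n) (u n) / Z) + d\<^sup>2"
    using nz by (simp add: var_def Z_def add_divide_distrib diff_divide_distrib)
  also have "lin (dev n) (u n) / Z = d"
    using gf_quotient[of dev n] mean_diff[OF nz] by (simp add: Z_def d_def)
  also have "lin (\<lambda>i. (dev n i)\<^sup>2) (u n) / Z = fps_nth U2 n / fps_nth U0 n"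
    using gf_quotient[of "\<lambda>n i. (dev n i)\<^sup>2" n] by (simp add: Z_def)
  finally show ?thesis
    using mean_diff[OF nz] by (simp add: d_def power2_eq_square)
qed

lemma cis_eq:
  "lin (\<lambda>i. cis (t * (real i - mean n))) (u n) / of_real (lin (\<lambda>_. 1) (u n))
    = cis (t * (\<mu> * real n - mean n)) * (fps_nth (gf (ch t) u) n / of_real (fps_nth U0 n))"
proof -
  have "cis (t * (real i - mean n)) = cis (t * (\<mu> * real n - mean n)) * ch t n i" for i
    by (simp add: ch_def dev_def cis_mult algebra_simps)
  then show ?thesis
    using gf_quotient[of "ch t" n] by (simp add: lin_fun_mult_left)
qed

text \<open>\<open>gf_ch_tendsto\<close> is applied at \<open>t / sqrt (var n)\<close>. Centring at
  the exact mean instead of \<open>\<mu> * n\<close> changes only a phase: the shift converges and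
  is multiplied by an argument tending to 0, so the phase tends to 1.\<close>

lemma standardised_char_tendsto:
  assumes nz: "\<And>n. lin (\<lambda>_. 1) (u n) \<noteq> (0::real)"
  shows "(\<lambda>n. lin (\<lambda>i. cis (t * ((real i - mean n) / sqrt (var n)))) (u n) / of_real (lin (\<lambda>_. 1) (u n)))
    \<longlonglongrightarrow> of_real (exp (- t\<^sup>2 / 2))"
proof -
  obtain l1 where l1: "(\<lambda>n. mean n - \<mu> * real n) \<longlonglongrightarrow> l1"
    using mean_tendsto unfolding mean_diff[OF nz, symmetric] ..
  obtain l2 where l2: "(\<lambda>n. var n - \<sigma>2 * real n) \<longlonglongrightarrow> l2"
    using variance_tendsto unfolding var_eq[OF nz, symmetric] ..
  have pos: "\<forall>\<^sub>F n in sequentially. var n > 0 \<and> n > 0"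
  proof -
    have "filterlim (\<lambda>n. \<sigma>2 * real n) at_top sequentially"
      using \<sigma>2_pos filterlim_real_sequentially by (rule filterlim_tendsto_pos_mult_at_top[OF tendsto_const])
    from filterlim_tendsto_add_at_top[OF l2 this]
    have "\<forall>\<^sub>F n in sequentially. var n > 0"
      by (simp add: filterlim_at_top_dense)
    then show ?thesis using eventually_gt_at_top[of 0] by eventually_elim simp
  qed
  have "(\<lambda>n. (var n - \<sigma>2 * real n) * inverse (real n) + \<sigma>2) \<longlonglongrightarrow> l2 * 0 + \<sigma>2"
    by (intro tendsto_add tendsto_mult l2 lim_inverse_n tendsto_const)
  then have "(\<lambda>n. t\<^sup>2 / ((var n - \<sigma>2 * real n) * inverse (real n) + \<sigma>2)) \<longlonglongrightarrow> t\<^sup>2 / \<sigma>2"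
    using \<sigma>2_pos by (intro tendsto_divide tendsto_const) auto
  moreover have "\<forall>\<^sub>F n in sequentially. t\<^sup>2 / ((var n - \<sigma>2 * real n) * inverse (real n) + \<sigma>2)
     = real n * (t / sqrt (var n))\<^sup>2"
    using pos by eventually_elim (simp add: power_divide field_simps)
  ultimately have th: "(\<lambda>n. real n * (t / sqrt (var n))\<^sup>2) \<longlonglongrightarrow> t\<^sup>2 / \<sigma>2"
    by (rule Lim_transform_eventually)
  have "(\<lambda>n. real n * (t / sqrt (var n))\<^sup>2 * inverse (real n)) \<longlonglongrightarrow> t\<^sup>2 / \<sigma>2 * 0"
    by (rule tendsto_mult[OF th lim_inverse_n])
  moreover have "\<forall>\<^sub>F n in sequentially. real n * (t / sqrt (var n))\<^sup>2 * inverse (real n) = (t / sqrt (var n))\<^sup>2"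
    using eventually_gt_at_top[of 0] by eventually_elim simp
  ultimately have "(\<lambda>n. (t / sqrt (var n))\<^sup>2) \<longlonglongrightarrow> 0" by (simp add: Lim_transform_eventually)
  then have "(\<lambda>n. \<bar>t / sqrt (var n)\<bar>) \<longlonglongrightarrow> 0"
    using tendsto_real_sqrt by fastforce
  then have th0: "(\<lambda>n. t / sqrt (var n)) \<longlonglongrightarrow> 0" by (rule tendsto_rabs_zero_cancel)
  have U0: "fps_nth U0 \<longlonglongrightarrow> A" by (rule near_const_tendsto[OF U0_near])
  have "(\<lambda>n. cis (- (t / sqrt (var n) * (mean n - \<mu> * real n)))
      * (fps_nth (gf (ch (t / sqrt (var n))) u) n / of_real (fps_nth U0 n)))
     \<longlonglongrightarrow> cis (- (0 * l1)) * (of_real (A * exp (- \<sigma>2 * (t\<^sup>2 / \<sigma>2) / 2)) / of_real A)"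
    using A_pos
    by (intro tendsto_mult tendsto_divide tendsto_of_real U0 gf_ch_tendsto[OF th] tendsto_cis tendsto_minus th0 l1) auto
  also have "cis (- (0 * l1)) * (of_real (A * exp (- \<sigma>2 * (t\<^sup>2 / \<sigma>2) / 2)) / of_real A) = of_real (exp (- t\<^sup>2 / 2))"
    using A_pos \<sigma>2_pos by simp
  finally have lim: "(\<lambda>n. cis (- (t / sqrt (var n) * (mean n - \<mu> * real n)))
      * (fps_nth (gf (ch (t / sqrt (var n))) u) n / of_real (fps_nth U0 n))) \<longlonglongrightarrow> of_real (exp (- t\<^sup>2 / 2))" .
  have "t * ((real i - mean n) / sqrt (var n)) = t / sqrt (var n) * (real i - mean n)"
    and "t / sqrt (var n) * (\<mu> * real n - mean n) = - (t / sqrt (var n) * (mean n - \<mu> * real n))" for n i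
    by (simp_all add: algebra_simps)
  then show ?thesis using lim by (simp only: cis_eq)
qed

end

section \<open>The number of distinct parts\<close>

text \<open>The factor \<open>fact m\<close> appears both in the weighted sum and in the number of
  compositions, and cancels. The range of \<open>g\<close> is general to cover real moments and
  complex characteristic functions.\<close>

lemma expectation_random_composition:
  fixes g :: "nat \<Rightarrow> 'a::{banach, second_countable_topology}"
  assumes b: "b \<ge> 2"
  shows "lin (\<lambda>_. 1) (level_poly b 1 n) > (0::real)"
    and "measure_pmf.expectation (random_composition b (Suc n)) (\<lambda>ks. g (distinct_parts ks))
      = lin g (level_poly b 1 n) /\<^sub>R lin (\<lambda>_. 1) (level_poly b 1 n)"
proof -
  define m where "m = (b - 1) * Suc n + 1"
  let ?C = "compositions b m" and ?p = "level_poly b 1 n"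
  have ne: "?C \<noteq> {}" unfolding m_def by (rule compositions_nonempty[OF b])
  have fin: "finite ?C" by (rule finite_compositions[OF b])
  have sum: "(\<Sum>ks\<in>?C. h (distinct_parts ks)) = fact m *\<^sub>R lin h ?p" for h :: "nat \<Rightarrow> 'c::real_normed_vector"
  proof -
    have "(\<Sum>ks\<in>?C. h (distinct_parts ks)) = lin h (\<Sum>ks\<in>?C. monom 1 (distinct_parts ks))"
      by (simp add: lin_sum lin_monom)
    then show ?thesis using sum_compositions_level_poly[OF b, of n] by (simp add: m_def lin_smult)
  qed
  have card: "real (card ?C) = fact m * lin (\<lambda>_. 1) ?p"
    using sum[of "\<lambda>_. 1 :: real"] by simp
  moreover have "real (card ?C) > 0" using ne fin by (simp add: card_gt_0_iff)
  ultimately show "lin (\<lambda>_. 1) ?p > (0::real)" by (simp add: zero_less_mult_iff)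
  have "measure_pmf.expectation (random_composition b (Suc n)) (\<lambda>ks. g (distinct_parts ks))
      = (\<Sum>ks\<in>?C. pmf (pmf_of_set ?C) ks *\<^sub>R g (distinct_parts ks))"
    unfolding random_composition_def m_def[symmetric]
    by (rule integral_measure_pmf) (use ne fin in auto)
  also have "\<dots> = (\<Sum>ks\<in>?C. g (distinct_parts ks)) /\<^sub>R real (card ?C)"
    using ne fin by (simp add: scaleR_sum_right indicator_def divide_inverse)
  finally show "measure_pmf.expectation (random_composition b (Suc n)) (\<lambda>ks. g (distinct_parts ks))
      = lin g ?p /\<^sub>R lin (\<lambda>_. 1) ?p"
    by (simp add: sum card)
qed

lemma renewal_polys_level_poly:
  assumes b: "b \<ge> 2"
  obtains r where "renewal_polys (passage_poly b 1 1) (passage_poly b 0 1) (level_poly b 1) r"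
proof -
  obtain r :: real where r: "r > 0"
    "\<And>j. j \<le> 1 \<Longrightarrow> geom_decay (Abs_fps (\<lambda>n. poly (passage_poly b j 1 n) 1 * r ^ n))"
    "(\<Sum>n. poly (passage_poly b 1 1 n) 1 * r ^ n) = 1"
    using passage_growth[OF b] by blast
  obtain d where d: "d < 3" "coeff (passage_poly b 1 1 3) d > 0"
    using coeff_passage_poly_3[OF b] by blast
  have "renewal_polys (passage_poly b 1 1) (passage_poly b 0 1) (level_poly b 1) r"
  proof
    show "\<exists>k d. 0 < coeff (passage_poly b 1 1 k) d \<and> d \<noteq> k"
      using d by (intro exI[of _ 3] exI[of _ d]) auto
    \<comment> \<open>The path that steps from 1 directly to 0 has length 0.\<close>
    show "\<exists>k. 0 < poly (passage_poly b 0 1 k) 1"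
      by (rule exI[of _ 0], subst passage_poly.simps) simp
    show "passage_poly b 1 1 0 = 0" by (rule passage_poly_1_0)
    show "level_poly b 1 n = passage_poly b 0 1 n + (\<Sum>k\<le>n. passage_poly b 1 1 k * level_poly b 1 (n - k))" for n
      by (rule level_poly_renewal[OF b]) simp
    show "0 < coeff (passage_poly b 1 1 1) 1"
      unfolding coeff_passage_poly_1[OF b] by simp
  qed (use r b in \<open>auto intro: coeff_passage_poly_nonneg degree_passage_poly\<close>)
  then show ?thesis by (rule that)
qed

theorem theorem7:
  fixes b :: nat
  assumes "b \<ge> 2"
  shows "\<exists>\<mu> \<sigma> :: real.
      asymptotically_normal (\<lambda>n. measure_pmf (random_composition b n))
        (\<lambda>n ks. real (distinct_parts ks)) \<and>
      (\<lambda>n. measure_pmf.expectation (random_composition b n) (\<lambda>ks. real (distinct_parts ks))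
            - \<mu> * real n) \<in> O(\<lambda>_. 1) \<and>
      (\<lambda>n. measure_pmf.variance (random_composition b n) (\<lambda>ks. real (distinct_parts ks))
            - \<sigma>\<^sup>2 * real n) \<in> O(\<lambda>_. 1)"
proof -
  obtain r where "renewal_polys (passage_poly b 1 1) (passage_poly b 0 1) (level_poly b 1) r"
    using renewal_polys_level_poly[OF assms] by blast
  then interpret renewal_polys "passage_poly b 1 1" "passage_poly b 0 1" "level_poly b 1" r .
  note E = expectation_random_composition[OF assms]
  define M where "M n = measure_pmf (random_composition b n)" for n
  define X where "X ks = real (distinct_parts ks)" for ks
  define mX where "mX n = prob_space.expectation (M n) X" for n
  define vX where "vX n = prob_space.expectation (M n) (\<lambda>ks. (X ks - mX n)\<^sup>2)" for n
  have nz: "lin (\<lambda>_. 1) (level_poly b 1 n) \<noteq> (0::real)" for n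
    using E(1)[of n] by simp
  have mX: "mX (Suc n) = mean n" for n
    unfolding mX_def M_def X_def mean_def by (subst E(2)) (simp add: divide_inverse)
  have vX: "vX (Suc n) = var n" for n
    unfolding vX_def mX unfolding M_def X_def var_def
    by (subst E(2)) (simp add: divide_inverse)
  \<comment> \<open>Index \<open>n\<close> of the renewal polynomials belongs to
    \<open>Suc n\<close> inner vertices; this shift alters the centred sequence only by the constant
    \<open>a\<close>.\<close>
  have bigo: "(\<lambda>n. h n - a * real n) \<in> O(\<lambda>_. 1)"
    if ex: "\<exists>l. (\<lambda>n. h (Suc n) - a * real n) \<longlonglongrightarrow> l" for h :: "nat \<Rightarrow> real" and a
  proof -
    obtain l where "(\<lambda>n. h (Suc n) - a * real n) \<longlonglongrightarrow> l" using ex by blast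
    then have "(\<lambda>n. (h (Suc n) - a * real n) - a) \<longlonglongrightarrow> l - a" by (intro tendsto_diff tendsto_const)
    then have "(\<lambda>n. h (Suc n) - a * real (Suc n)) \<longlonglongrightarrow> l - a" by (simp add: algebra_simps)
    then have "(\<lambda>n. h n - a * real n) \<longlonglongrightarrow> l - a" by (rule LIMSEQ_imp_Suc)
    then show ?thesis by (intro bigoI_tendsto[where c = "l - a"]) auto
  qed
  have "asymptotically_normal M (\<lambda>n. X)"
    unfolding asymptotically_normal_def mX_def[symmetric] vX_def[symmetric]
  proof (rule levy_continuity)
    fix n
    show "real_distribution (distr (M n) borel (\<lambda>ks. (X ks - mX n) / sqrt (vX n)))"
      unfolding M_def by (rule prob_space.real_distribution_distr) (auto simp: measure_pmf.prob_space_axioms)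
  next
    fix t
    have char: "char (distr (M n) borel (\<lambda>ks. (X ks - mX n) / sqrt (vX n))) t
        = measure_pmf.expectation (random_composition b n)
            (\<lambda>ks. cis (t * ((real (distinct_parts ks) - mX n) / sqrt (vX n))))" for n
      unfolding char_def M_def X_def by (subst integral_distr) (auto simp: cis_conv_exp)
    have "char (distr (M (Suc n)) borel (\<lambda>ks. (X ks - mX (Suc n)) / sqrt (vX (Suc n)))) t
        = lin (\<lambda>i. cis (t * ((real i - mean n) / sqrt (var n)))) (level_poly b 1 n)
          / of_real (lin (\<lambda>_. 1) (level_poly b 1 n))" for n
      unfolding char unfolding mX vX unfolding E(2)[where g = "\<lambda>i. cis (t * ((real i - mean n) / sqrt (var n)))"]
      by (simp add: scaleR_conv_of_real divide_inverse_commute)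
    then have "(\<lambda>n. char (distr (M (Suc n)) borel (\<lambda>ks. (X ks - mX (Suc n)) / sqrt (vX (Suc n)))) t)
        \<longlonglongrightarrow> of_real (exp (- t\<^sup>2 / 2))"
      using standardised_char_tendsto[OF nz, of t] by simp
    then show "(\<lambda>n. char (distr (M n) borel (\<lambda>ks. (X ks - mX n) / sqrt (vX n))) t)
        \<longlonglongrightarrow> char std_normal_distribution t"
      unfolding char_std_normal_distribution by (rule LIMSEQ_imp_Suc)
  qed (rule real_dist_normal_dist)
  moreover have "(\<lambda>n. mX n - \<mu> * real n) \<in> O(\<lambda>_. 1)"
    by (rule bigo, unfold mX mean_diff[OF nz], rule mean_tendsto)
  moreover have "(\<lambda>n. vX n - (sqrt \<sigma>2)\<^sup>2 * real n) \<in> O(\<lambda>_. 1)"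
    unfolding real_sqrt_pow2[OF less_imp_le[OF \<sigma>2_pos]]
    by (rule bigo, unfold vX var_eq[OF nz], rule variance_tendsto)
  ultimately show ?thesis
    unfolding vX_def mX_def M_def X_def by blast
qed

end
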